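(* Let $p_n\in[0,1]$ be such that $p_n\to 0$ and $n p_n/\ln n\to\infty$ as $n\to\infty$ (subcritical regime). Let $I_n$ be the number of fireproof vertices after the fire dynamics with parameter $p_n$ on a random recursive tree $\mathsf{T}_n$ with $n$ vertices. Then, as $n\to\infty$, $$\frac{p_n}{\ln(1/p_n)}\, I_n \longrightarrow \epsilon_1\quad\text{in distribution,}$$ where $\epsilon_1$ is an exponential random variable with rate $1$.
   Context: Write $[n]=\{1,\dots,n\}$. A tree on the vertex set $[n]$ is called recursive if, when rooted at $1$, the sequence of vertices along any branch from the root to a leaf is increasing. There are $(n-1)!$ such trees; the random recursive tree $\mathsf{T}_n$ is one of them picked uniformly at random. Fire dynamics with parameter $p_n$ on a tree with $n$ vertices: initially every edge is flammable. The edges are considered successively in a uniform random order; an edge which has already burnt is not subject to the dynamics any more and is skipped. Otherwise, independently of everything else, the edge becomes fireproof with probability $1-p_n$ or is set on fire with probability $p_n$; in the latter case the edge burns, sets on fire its flammable neighbouring edges, and the fire propagates instantly, stopped only by fireproof edges (so that the whole connected set of flammable edges containing it burns). The dynamics continue until all edges are either burnt or fireproof. A vertex is called fireproof if all its adjacent edges are fireproof, and burnt otherwise. *)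

theory Defs
  imports "HOL-Probability.Probability"
begin

text \<open>Undirected graphs are given by a vertex set \<open>V\<close> and a set \<open>E\<close> of two-element subsets of \<open>V\<close>.\<close>

definition simple_path :: "'a set set \<Rightarrow> 'a list \<Rightarrow> bool" where
  "simple_path E xs \<longleftrightarrow> xs \<noteq> [] \<and> distinct xs \<and> successively (\<lambda>u v. {u, v} \<in> E) xs"

definition simple_cycle :: "'a set set \<Rightarrow> 'a list \<Rightarrow> bool" where
  "simple_cycle E xs \<longleftrightarrow> length xs \<ge> 3 \<and> simple_path E xs \<and> {last xs, hd xs} \<in> E"

definition tree_on :: "'a set \<Rightarrow> 'a set set \<Rightarrow> bool" where
  "tree_on V E \<longleftrightarrow>
     E \<subseteq> {e. e \<subseteq> V \<and> card e = 2} \<and>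
     (\<forall>u\<in>V. \<forall>v\<in>V. \<exists>xs. simple_path E xs \<and> hd xs = u \<and> last xs = v) \<and>
     (\<nexists>xs. simple_cycle E xs)"

definition leaf_of :: "'a \<Rightarrow> 'a set \<Rightarrow> 'a set set \<Rightarrow> 'a \<Rightarrow> bool" where
  "leaf_of r V E v \<longleftrightarrow> v \<in> V \<and> v \<noteq> r \<and> card {e \<in> E. v \<in> e} = 1"

definition recursive_trees :: "nat \<Rightarrow> nat set set set" where
  "recursive_trees n = {E. tree_on {1..n} E \<and>
     (\<forall>xs. simple_path E xs \<and> hd xs = 1 \<and> leaf_of 1 {1..n} E (last xs) \<longrightarrow> sorted_wrt (<) xs)}"

datatype edge_state = Flammable | Fireproof | Burnt

definition fire_cluster :: "'a set set \<Rightarrow> ('a set \<Rightarrow> edge_state) \<Rightarrow> 'a set \<Rightarrow> 'a set set" where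
  "fire_cluster E s e =
     {(f, g). f \<in> E \<and> g \<in> E \<and> s f = Flammable \<and> s g = Flammable \<and> f \<inter> g \<noteq> {}}\<^sup>* `` {e}"

definition fire_step ::
  "'a set set \<Rightarrow> real \<Rightarrow> ('a set \<Rightarrow> edge_state) \<Rightarrow> 'a set \<Rightarrow> ('a set \<Rightarrow> edge_state) pmf" where
  "fire_step E p s e =
     (if s e = Burnt then return_pmf s
      else map_pmf (\<lambda>fire. if fire then (\<lambda>f. if f \<in> fire_cluster E s e then Burnt else s f)
                           else s(e := Fireproof))
             (bernoulli_pmf p))"

primrec fire_run ::
  "'a set set \<Rightarrow> real \<Rightarrow> ('a set \<Rightarrow> edge_state) \<Rightarrow> 'a set list \<Rightarrow> ('a set \<Rightarrow> edge_state) pmf" where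
  "fire_run E p s [] = return_pmf s"
| "fire_run E p s (e # es) = bind_pmf (fire_step E p s e) (\<lambda>s'. fire_run E p s' es)"

definition fire_dynamics :: "'a set set \<Rightarrow> real \<Rightarrow> ('a set \<Rightarrow> edge_state) pmf" where
  "fire_dynamics E p =
     bind_pmf (pmf_of_set (permutations_of_set E)) (fire_run E p (\<lambda>_. Flammable))"

definition fireproof_vertices :: "'a set \<Rightarrow> 'a set set \<Rightarrow> ('a set \<Rightarrow> edge_state) \<Rightarrow> 'a set" where
  "fireproof_vertices V E s = {v \<in> V. \<forall>e\<in>E. v \<in> e \<longrightarrow> s e = Fireproof}"

text \<open>The law of the number of fireproof vertices after the dynamics with parameter \<open>p\<close> on a
  random recursive tree with \<open>n\<close> vertices.\<close>

definition fireproof_count_pmf :: "nat \<Rightarrow> real \<Rightarrow> nat pmf" where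
  "fireproof_count_pmf n p =
     bind_pmf (pmf_of_set (recursive_trees n))
       (\<lambda>E. map_pmf (\<lambda>s. card (fireproof_vertices {1..n} E s)) (fire_dynamics E p))"

end

theory Submission
  imports Defs "HOL-Real_Asymp.Real_Asymp"
begin

text \<open>Removing the first inspected edge of a random recursive tree of size \<open>n\<close> leaves two trees
  which, given their sizes, are independent random recursive trees; the one not containing the root has
  size \<open>k\<close> with probability \<open>n / ((n - 1) * k * (k + 1))\<close>. If that edge burns, every vertex burns, and
  otherwise the dynamics go on independently on the two parts. Hence the characteristic functions
  \<open>\<phi> n\<close> of the number of fireproof vertices at a frequency \<open>\<theta>\<close> satisfy
  \<open>\<phi> n = p + (1 - p) * E (\<phi> K * \<phi> (n - K))\<close>.

  For \<open>\<theta> = t * p / ln (1 / p)\<close> only the sizes \<open>k\<close> up to order \<open>1 / p\<close> matter in \<open>E (\<phi> K)\<close>; there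
  \<open>\<phi> k\<close> is close to \<open>1 + \<i> * k * \<theta>\<close>, and summing the weights \<open>1 / (k * (k + 1))\<close> produces the
  factor \<open>ln (1 / p)\<close>, so that \<open>E (\<phi> K)\<close> is \<open>1 + \<i> * t * p\<close> up to \<open>o(p)\<close>. As \<open>n * p\<close> is large compared to
  \<open>ln n\<close>, the part containing the root keeps its order of magnitude during the \<open>1 / p\<close> steps before the
  fire, and \<open>\<phi> n\<close> is close to the solution \<open>1 / (1 - \<i> * t * (1 - p))\<close> of
  \<open>\<psi> = p + (1 - p) * (1 + \<i> * t * p) * \<psi>\<close>.\<close>

section \<open>The splitting recursion\<close>

text \<open>Heuristically the root part survives a geometric number of steps of mean
  \<open>1 / p\<close>, and each step severs a part that contributes on average about
  \<open>ln (1 / p)\<close> fireproof vertices: this explains both the scaling and the exponential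
  law. The untruncated mean size of a severed part is of order \<open>ln n\<close>, so the root part
  loses about \<open>ln n / p\<close> vertices before it burns; this is where \<open>n * p\<close>
  has to dominate \<open>ln n\<close>.

  The obstacle is that the recursion is quadratic in \<phi>. Its two factors are treated
  differently: \<phi> at the severed size enters only through its average, and only \<phi> at the
  size of the root part is compared with the limit. What results is a linear contraction with factor
  about \<open>1 - p\<close>, so the average has to be known up to an error small compared to
  \<open>p\<close>.

  The parameters \<open>p\<close> and \<theta> stay fixed while the recursion visits all smaller
  sizes; the limit uses only the diagonal, where they belong to the size itself.\<close>

definition split_weight :: "nat \<Rightarrow> nat \<Rightarrow> real" where
  "split_weight n k = real n / (real (n - 1) * (real k * (real k + 1)))"

lemma split_weight_nonneg [simp]: "split_weight n k \<ge> 0"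
  by (simp add: split_weight_def)

section \<open>Sums of the splitting weights\<close>

lemma sum_inverse_consecutive:
  "(\<Sum>k=1..<n. 1 / (real k * (real k + 1))) = real (n - 1) / real n"
proof (induction n)
  case (Suc n)
  have "(real n - 1) / real n + 1 / (real n * (real n + 1)) = real n / (real n + 1)" if "0 < n"
  proof -
    have "(real n - 1) / real n + 1 / (real n * (real n + 1))
        = ((real n - 1) * (real n + 1) + 1) / (real n * (real n + 1))"
      using that by (simp add: add_divide_distrib)
    also have "(real n - 1) * (real n + 1) + 1 = real n * real n"
      by (simp add: algebra_simps)
    finally show ?thesis by simp
  qed
  with Suc show ?case
    by (cases n) (simp_all add: algebra_simps)
qed simp

lemma sum_inverse_consecutive_tail:
  assumes "1 \<le> a"
  shows "(\<Sum>k=a..<n. 1 / (real k * (real k + 1))) \<le> 1 / real a"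
proof (cases "a \<le> n")
  case True
  then have "(\<Sum>k=a..<n. 1 / (real k * (real k + 1))) = 1 / real a - 1 / real n"
    using assms
  proof (induction n rule: dec_induct)
    case (step m)
    then have "1 / (real m * (real m + 1)) = 1 / real m - 1 / real (Suc m)"
      by (simp add: field_simps)
    with step show ?case by simp
  qed simp
  then show ?thesis by simp
qed simp

lemma sum_split_weight:
  assumes "2 \<le> n"
  shows "(\<Sum>k=1..<n. split_weight n k) = 1"
proof -
  have "(\<Sum>k=1..<n. split_weight n k)
      = real n / real (n - 1) * (\<Sum>k=1..<n. 1 / (real k * (real k + 1)))"
    unfolding split_weight_def sum_distrib_left by (intro sum.cong) auto
  with assms show ?thesis
    by (subst (asm) sum_inverse_consecutive) simp
qed

lemma sum_inverse_Suc: "(\<Sum>k=1..<n. 1 / (real k + 1)) = harm n - 1" if "1 \<le> n"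
  using that by (induction n rule: dec_induct) (auto simp: harm_expand harm_Suc inverse_eq_divide add.commute)

lemma harm_le_ln: "harm n \<le> 1 + ln (real n)" if "1 \<le> n"
proof -
  have "harm (Suc m) \<le> 1 + ln (real (Suc m))" for m
  proof -
    have "harm (Suc m) - ln (real (Suc m)) \<le> harm (Suc 0) - ln (real (Suc 0))"
      using decseqD[OF decseq_harm_diff_ln, of 0 m] by simp
    then show ?thesis by (simp add: harm_expand)
  qed
  from this[of "n - 1"] that show ?thesis by simp
qed

text \<open>This is the expected loss of the root part in one step. It follows from
  \<open>n / (n - 1) \<le> 2\<close> and \<open>harm n - 1 \<le> ln n\<close>.\<close>

lemma split_weight_mean_le:
  assumes "2 \<le> n"
  shows "(\<Sum>k=1..<n. split_weight n k * real k) \<le> 2 * ln (real n)"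
proof -
  have "(\<Sum>k=1..<n. split_weight n k * real k)
      = real n / real (n - 1) * (\<Sum>k=1..<n. 1 / (real k + 1))"
    unfolding split_weight_def sum_distrib_left by (intro sum.cong) auto
  also have "\<dots> \<le> 2 * ln (real n)"
  proof (rule mult_mono)
    show "real n / real (n - 1) \<le> 2"
      using assms by (simp add: field_simps of_nat_diff)
    show "(\<Sum>k=1..<n. 1 / (real k + 1)) \<le> ln (real n)"
      using assms sum_inverse_Suc[of n] harm_le_ln[of n] by simp
  qed (auto intro!: sum_nonneg)
  finally show ?thesis .
qed

section \<open>A priori bounds on solutions of the splitting recursion\<close>

locale split_recursion =
  fixes \<phi> :: "nat \<Rightarrow> complex" and p \<theta> :: real
  assumes p01: "0 \<le> p" "p \<le> 1"
    and phi_one: "\<phi> 1 = cis \<theta>"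
    and phi_rec: "\<And>n. 2 \<le> n \<Longrightarrow> \<phi> n = of_real p +
      of_real (1 - p) * (\<Sum>k=1..<n. of_real (split_weight n k) * (\<phi> k * \<phi> (n - k)))"
begin

text \<open>The weights sum to 1, so \<open>\<phi> n - x\<close> is a convex combination of
  \<open>1 - x\<close>, with weight \<open>p\<close>, and of the differences in the hypothesis. It
  serves as the induction step of the comparison with
  \<open>cis (real n * \<theta>)\<close>.\<close>

lemma phi_diff_le:
  assumes n: "2 \<le> n"
    and bound: "\<And>k. 1 \<le> k \<Longrightarrow> k < n \<Longrightarrow> norm (\<phi> k * \<phi> (n - k) - x) \<le> B"
  shows "norm (\<phi> n - x) \<le> p * norm (1 - x) + B"
proof -
  have B: "0 \<le> B" using order_trans[OF norm_ge_zero bound[of 1]] n by simp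
  let ?S = "\<Sum>k=1..<n. of_real (split_weight n k) * (\<phi> k * \<phi> (n - k) - x)"
  have "(\<Sum>k=1..<n. of_real (split_weight n k)) = (1::complex)"
    using sum_split_weight[OF n] by (metis of_real_1 of_real_sum)
  moreover have "?S = (\<Sum>k=1..<n. of_real (split_weight n k) * (\<phi> k * \<phi> (n - k)))
      - (\<Sum>k=1..<n. of_real (split_weight n k)) * x"
    by (simp only: right_diff_distrib sum_subtractf sum_distrib_right)
  ultimately have S_eq: "?S = (\<Sum>k=1..<n. of_real (split_weight n k) * (\<phi> k * \<phi> (n - k))) - x"
    by simp
  have "\<phi> n - x = of_real p * (1 - x) + of_real (1 - p) * ?S"
    unfolding phi_rec[OF n] S_eq by (simp add: algebra_simps)
  also have "norm \<dots> \<le> p * norm (1 - x) + (1 - p) * norm ?S"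
    using p01 by (intro norm_triangle_le) (simp add: norm_mult flip: of_real_diff)
  also have "norm ?S \<le> (\<Sum>k=1..<n. split_weight n k * B)"
    by (intro sum_norm_le) (use bound in \<open>auto simp: norm_mult intro!: mult_left_mono\<close>)
  also have "\<dots> = B" using sum_split_weight[OF n] by (simp flip: sum_distrib_right)
  also have "(1 - p) * B \<le> B" using p01 B by (simp add: mult_left_le_one_le)
  finally show ?thesis using p01 by (simp add: mult_left_mono)
qed

lemma norm_phi_le: "1 \<le> n \<Longrightarrow> norm (\<phi> n) \<le> 1"
proof (induction n rule: less_induct)
  case (less n)
  show ?case
  proof (cases "n = 1")
    case False
    with less have n: "2 \<le> n" by simp
    have "norm (\<phi> n) \<le> p + (1 - p) * norm (\<Sum>k=1..<n. of_real (split_weight n k) * (\<phi> k * \<phi> (n - k)))"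
      unfolding phi_rec[OF n] using p01 by (intro norm_triangle_le) (simp add: norm_mult flip: of_real_diff)
    also have "norm (\<Sum>k=1..<n. of_real (split_weight n k) * (\<phi> k * \<phi> (n - k))) \<le> (\<Sum>k=1..<n. split_weight n k * 1)"
      using less by (intro sum_norm_le) (auto simp: norm_mult intro!: mult_left_le mult_le_one)
    also have "\<dots> = 1" using sum_split_weight[OF n] by simp
    finally show ?thesis using p01 by (simp add: mult_left_mono)
  qed (use phi_one in simp)
qed

lemma norm_phi_mult_diff_le:
  assumes "1 \<le> k" "k < n" "norm y \<le> 1"
  shows "norm (\<phi> k * \<phi> (n - k) - x * y) \<le> norm (\<phi> k - x) + norm (\<phi> (n - k) - y)"
proof -
  have "norm (\<phi> k * \<phi> (n - k) - x * y) = norm (\<phi> k * (\<phi> (n - k) - y) + (\<phi> k - x) * y)"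
    by (simp add: algebra_simps)
  also have "\<dots> \<le> norm (\<phi> k) * norm (\<phi> (n - k) - y) + norm (\<phi> k - x) * norm y"
    by (intro norm_triangle_le) (simp add: norm_mult)
  also have "\<dots> \<le> 1 * norm (\<phi> (n - k) - y) + norm (\<phi> k - x) * 1"
    using assms by (intro add_mono mult_mono norm_phi_le) auto
  finally show ?thesis by simp
qed

lemma norm_one_minus_cis_le: "norm (1 - cis x) \<le> \<bar>x\<bar>"
  using iexp_approx1[of x 0] by (simp add: cis_conv_exp norm_minus_commute mult.commute)

text \<open>The value \<open>cis (real n * \<theta>)\<close> belongs to dynamics without fire. A
  union bound explains the size of the error: each of the \<open>n - 1\<close> edges is set on fire
  with probability at most \<open>p\<close>, and a fire then spoils at most \<open>n\<close>
  vertices.\<close>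

lemma norm_phi_minus_cis_le:
  "1 \<le> n \<Longrightarrow> norm (\<phi> n - cis (real n * \<theta>)) \<le> \<bar>\<theta>\<bar> * p * (real n * (real n - 1))"
proof (induction n rule: less_induct)
  case (less n)
  show ?case
  proof (cases "n = 1")
    case False
    with less have n: "2 \<le> n" by simp
    \<comment> \<open>Splitting \<open>n = k + j\<close> lowers \<open>n * (n - 1)\<close> by
      \<open>2 * k * j\<close>, which is at least \<open>n\<close>. The \<open>n\<close> subtracted
      here pays for the term \<open>p * norm (1 - cis (n * \<theta>))\<close>.\<close>
    let ?B = "\<bar>\<theta>\<bar> * p * (real n * (real n - 1) - real n)"
    have "norm (\<phi> k * \<phi> (n - k) - cis (real n * \<theta>)) \<le> ?B" if k: "1 \<le> k" "k < n" for k
    proof -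
      obtain j where j: "n = k + j" "1 \<le> j" using k by (intro that[of "n - k"]) auto
      have "cis (real n * \<theta>) = cis (real k * \<theta>) * cis (real (n - k) * \<theta>)"
        using k by (simp add: cis_mult of_nat_diff algebra_simps)
      then have "norm (\<phi> k * \<phi> (n - k) - cis (real n * \<theta>))
          \<le> norm (\<phi> k - cis (real k * \<theta>)) + norm (\<phi> (n - k) - cis (real (n - k) * \<theta>))"
        using norm_phi_mult_diff_le[OF k, of "cis (real (n - k) * \<theta>)" "cis (real k * \<theta>)"] by simp
      also have "\<dots> \<le> \<bar>\<theta>\<bar> * p * (real k * (real k - 1)) + \<bar>\<theta>\<bar> * p * (real (n - k) * (real (n - k) - 1))"
        using less.IH[of k] less.IH[of "n - k"] k by (intro add_mono) simp_all
      also have "\<dots> = \<bar>\<theta>\<bar> * p * (real k * (real k - 1) + real j * (real j - 1))"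
        using j by (simp add: algebra_simps)
      also have "\<dots> \<le> ?B"
      proof (rule mult_left_mono)
        have "0 \<le> (real k - 1) * (real j - 1)" "1 \<le> real k" "1 \<le> real j"
          using k j by auto
        moreover have "1 \<le> real k * real j"
          using k j mult_le_mono[of 1 k 1 j] by (simp flip: of_nat_mult)
        ultimately have "real k + real j \<le> 2 * (real k * real j)"
          by (simp add: algebra_simps)
        then show "real k * (real k - 1) + real j * (real j - 1) \<le> real n * (real n - 1) - real n"
          unfolding j by (simp add: algebra_simps)
      qed (use p01 in simp)
      finally show ?thesis .
    qed
    then have "norm (\<phi> n - cis (real n * \<theta>)) \<le> p * norm (1 - cis (real n * \<theta>)) + ?B"
      by (rule phi_diff_le[OF n])
    also have "p * norm (1 - cis (real n * \<theta>)) \<le> p * (real n * \<bar>\<theta>\<bar>)"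
      using norm_one_minus_cis_le[of "real n * \<theta>"] p01 by (intro mult_left_mono) (auto simp: abs_mult)
    finally show ?thesis by (simp add: algebra_simps)
  qed (use phi_one in simp)
qed

text \<open>The factor \<open>n * (n + 1)\<close> is chosen to cancel against the denominator of the
  splitting weight, so that every \<open>k\<close> contributes the same error to the average; it
  also absorbs the quadratic Taylor remainder of \<open>cis\<close>.\<close>

lemma norm_phi_linear_le:
  assumes "1 \<le> n"
  shows "norm (\<phi> n - 1 - \<i> * of_real (real n * \<theta>)) \<le> (\<bar>\<theta>\<bar> * p + \<theta>\<^sup>2) * (real n * (real n + 1))"
proof -
  let ?x = "real n * \<theta>"
  have "norm (cis ?x - (1 + \<i> * of_real ?x)) \<le> ?x\<^sup>2 / 2"
    using iexp_approx1[of ?x 1] by (simp add: cis_conv_exp power2_eq_square mult.commute)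
  also have "\<dots> = \<theta>\<^sup>2 * ((real n)\<^sup>2 / 2)"
    by (simp add: power_mult_distrib)
  also have "\<dots> \<le> \<theta>\<^sup>2 * (real n * (real n + 1))"
    by (intro mult_left_mono) (auto simp: power2_eq_square algebra_simps)
  finally have *: "norm (cis ?x - (1 + \<i> * of_real ?x)) \<le> \<theta>\<^sup>2 * (real n * (real n + 1))" .
  have "\<bar>\<theta>\<bar> * p * (real n * (real n - 1)) \<le> \<bar>\<theta>\<bar> * p * (real n * (real n + 1))"
    using p01 by (intro mult_left_mono) auto
  with norm_phi_minus_cis_le[OF assms] * 
  have "norm ((\<phi> n - cis ?x) + (cis ?x - (1 + \<i> * of_real ?x))) \<le> \<bar>\<theta>\<bar> * p * (real n * (real n + 1)) + \<theta>\<^sup>2 * (real n * (real n + 1))"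
    by (intro norm_triangle_le add_mono) auto
  then show ?thesis by (simp add: algebra_simps)
qed

text \<open>The crude bound \<open>norm (\<phi> k - 1) \<le> 2\<close> suffices for \<open>k \<ge> N\<close>, the linear approximation
  \<open>\<phi> k \<approx> 1 + \<i> * k * \<theta>\<close> for \<open>k < N\<close>.\<close>

lemma norm_sum_phi_le:
  assumes N: "1 \<le> N" "N \<le> m"
  shows "norm ((\<Sum>k=1..<m. (\<phi> k - 1) / of_real (real k * (real k + 1))) - \<i> * of_real s)
    \<le> (\<bar>\<theta>\<bar> * p + \<theta>\<^sup>2) * real N + \<bar>\<theta> * (harm N - 1) - s\<bar> + 2 / real N"
proof -
  let ?d = "\<lambda>k. real k * (real k + 1)"
  let ?f = "\<lambda>k. (\<phi> k - 1) / of_real (?d k)"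
  let ?g = "\<lambda>k. (\<phi> k - 1 - \<i> * of_real (real k * \<theta>)) / of_real (?d k)"
  let ?h = "\<lambda>k. \<i> * of_real \<theta> * of_real (1 / (real k + 1))"
  \<comment> \<open>The linear term loses its factor \<open>k\<close> against the denominator; what
    remains sums to a harmonic number.\<close>
  have fgh: "?f k = ?g k + ?h k" if "1 \<le> k" for k
  proof -
    have *: "x / (a * b) = (x - \<i> * (a * t)) / (a * b) + \<i> * t * (1 / b)"
      if "a \<noteq> 0" "b \<noteq> 0" for a b x t :: complex
      using that by (simp add: diff_divide_distrib)
    have "complex_of_real (real k) \<noteq> 0" "complex_of_real (real k + 1) \<noteq> 0"
      using that by (simp_all only: of_real_eq_0_iff)
    from *[OF this, of "\<phi> k - 1" "of_real \<theta>"] show ?thesis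
      unfolding of_real_mult of_real_divide of_real_1 .
  qed
  have "(\<Sum>k=1..<m. ?f k) = (\<Sum>k=1..<N. ?f k) + (\<Sum>k=N..<m. ?f k)"
    using N by (simp add: sum.atLeastLessThan_concat)
  also have "(\<Sum>k=1..<N. ?f k) = (\<Sum>k=1..<N. ?g k) + (\<Sum>k=1..<N. ?h k)"
    unfolding sum.distrib[symmetric] by (rule sum.cong[OF refl], rule fgh) simp
  also have "(\<Sum>k=1..<N. ?h k) = \<i> * of_real (\<theta> * (harm N - 1))"
    using sum_inverse_Suc[OF N(1)]
    by (simp only: of_real_mult sum_distrib_left[symmetric] of_real_sum[symmetric] mult.assoc)
  finally have "(\<Sum>k=1..<m. ?f k) - \<i> * of_real s
     = (\<Sum>k=1..<N. ?g k) + \<i> * of_real (\<theta> * (harm N - 1) - s) + (\<Sum>k=N..<m. ?f k)"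
    by (simp add: algebra_simps)
  also have "norm \<dots> \<le> norm (\<Sum>k=1..<N. ?g k) + \<bar>\<theta> * (harm N - 1) - s\<bar> + norm (\<Sum>k=N..<m. ?f k)"
    by (intro norm_triangle_le add_mono order_refl) (simp add: norm_mult del: of_real_diff of_real_mult)
  also have "norm (\<Sum>k=1..<N. ?g k) \<le> (\<Sum>k=1..<N. \<bar>\<theta>\<bar> * p + \<theta>\<^sup>2)"
  proof (intro sum_norm_le)
    fix k assume "k \<in> {1..<N}"
    then have k: "1 \<le> k" by simp
    then have "0 < ?d k" by simp
    then show "norm (?g k) \<le> \<bar>\<theta>\<bar> * p + \<theta>\<^sup>2"
      using norm_phi_linear_le[OF k] by (simp only: norm_divide norm_of_real abs_of_pos pos_divide_le_eq)
  qed
  also have "\<dots> \<le> (\<bar>\<theta>\<bar> * p + \<theta>\<^sup>2) * real N"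
    using p01 by (simp add: mult.commute mult_right_mono)
  also have "norm (\<Sum>k=N..<m. ?f k) \<le> (\<Sum>k=N..<m. 2 * (1 / ?d k))"
  proof (intro sum_norm_le)
    fix k assume "k \<in> {N..<m}"
    then have k: "1 \<le> k" using N by simp
    have "norm (\<phi> k - 1) \<le> 2"
      using norm_phi_le[OF k] norm_triangle_ineq4[of "\<phi> k" 1] by simp
    moreover have "0 < ?d k" using k by simp
    ultimately show "norm (?f k) \<le> 2 * (1 / ?d k)"
      by (simp only: norm_divide norm_of_real abs_of_pos divide_right_mono times_divide_eq_right mult_1_right less_imp_le)
  qed
  also have "\<dots> \<le> 2 * (1 / real N)"
    unfolding sum_distrib_left[symmetric] by (intro mult_left_mono sum_inverse_consecutive_tail N) simp
  finally show ?thesis by simp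
qed


text \<open>As the weights sum to 1, only \<open>\<phi> k - 1\<close> has to be averaged. The
  prefactor \<open>m / (m - 1) = 1 + 1 / (m - 1)\<close> at most doubles the error and shifts the
  main term by \<open>s / (m - 1)\<close>.\<close>

lemma split_average_phi_le:
  assumes m: "2 \<le> m"
    and le: "norm ((\<Sum>k=1..<m. (\<phi> k - 1) / of_real (real k * (real k + 1))) - \<i> * of_real s) \<le> \<epsilon>"
  shows "norm ((\<Sum>k=1..<m. of_real (split_weight m k) * \<phi> k) - (1 + \<i> * of_real s))
    \<le> 2 * \<epsilon> + \<bar>s\<bar> / real (m - 1)"
proof -
  let ?S = "\<Sum>k=1..<m. (\<phi> k - 1) / of_real (real k * (real k + 1))"
  have "(\<Sum>k=1..<m. of_real (split_weight m k)) = (1::complex)"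
    using sum_split_weight[OF m] by (metis of_real_1 of_real_sum)
  moreover have "(\<Sum>k=1..<m. of_real (split_weight m k) * \<phi> k)
      = (\<Sum>k=1..<m. of_real (split_weight m k)) + (\<Sum>k=1..<m. of_real (split_weight m k) * (\<phi> k - 1))"
    unfolding sum.distrib[symmetric] by (simp add: right_diff_distrib)
  moreover have "(\<Sum>k=1..<m. of_real (split_weight m k) * (\<phi> k - 1)) = of_real (real m / real (m - 1)) * ?S"
    unfolding sum_distrib_left by (intro sum.cong) (auto simp: split_weight_def)
  moreover have "real m / real (m - 1) = 1 + 1 / real (m - 1)"
    using m by (simp add: field_simps of_nat_diff)
  ultimately have "(\<Sum>k=1..<m. of_real (split_weight m k) * \<phi> k) - (1 + \<i> * of_real s)
      = of_real (1 + 1 / real (m - 1)) * (?S - \<i> * of_real s) + of_real (1 / real (m - 1)) * (\<i> * of_real s)"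
    by (simp add: algebra_simps del: of_real_divide)
  also have "norm \<dots> \<le> \<bar>1 + 1 / real (m - 1)\<bar> * norm (?S - \<i> * of_real s) + \<bar>1 / real (m - 1)\<bar> * \<bar>s\<bar>"
    by (rule order_trans[OF norm_triangle_ineq])
       (simp only: norm_mult norm_of_real norm_ii mult_1_left order_refl)
  also have "\<dots> \<le> 2 * \<epsilon> + \<bar>s\<bar> / real (m - 1)"
    using m le by (intro add_mono mult_mono) (auto simp: of_nat_diff)
  finally show ?thesis .
qed

text \<open>Since \<open>\<psi>\<close> is the fixed point of \<open>z \<mapsto> p + (1 - p) * c * z\<close>, the error \<open>norm (\<phi> m - \<psi>)\<close> is
  compared with the supersolution \<open>C + 4 * (n - m) / n\<close>: it exceeds the trivial bound \<open>2\<close> for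
  \<open>m \<le> n / 2\<close>, and the small drift of \<open>m \<mapsto> m - k\<close> is absorbed by the killing rate \<open>p\<close>.\<close>

lemma norm_phi_minus_fixed_point_le:
  assumes p: "0 < p" and n: "2 \<le> n" and \<beta>: "0 \<le> \<beta>"
    and \<psi>: "\<psi> = of_real p + of_real (1 - p) * c * \<psi>" "norm \<psi> \<le> 1"
    and avg: "\<And>m. 2 \<le> m \<Longrightarrow> n < 2 * m \<Longrightarrow> m \<le> n \<Longrightarrow>
      norm ((\<Sum>k=1..<m. of_real (split_weight m k) * \<phi> k) - c) \<le> \<beta> * p"
  shows "norm (\<phi> n - \<psi>) \<le> \<beta> + 8 * ln (real n) / (real n * p)"
proof -
  \<comment> \<open>Chosen so that \<open>p * C\<close> is the sum of the two errors of one step: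
    \<open>\<beta> * p\<close> from the average, and the slope \<open>4 / n\<close> times the mean
    loss \<open>2 * ln n\<close>.\<close>
  define C where "C = \<beta> + 8 * ln (real n) / (real n * p)"
  define h where "h = (\<lambda>m. C + 4 / real n * (real n - real m))"
  have C: "0 \<le> C" using n \<beta> p by (simp add: C_def)
  have "1 \<le> m \<Longrightarrow> m \<le> n \<Longrightarrow> norm (\<phi> m - \<psi>) \<le> h m" for m
  proof (induction m rule: less_induct)
    case (less m)
    show ?case
    proof (cases "2 * m \<le> n")
      case True
      have "2 = 4 / real n * (real n - real n / 2)" using n by simp
      also have "\<dots> \<le> h m"
        unfolding h_def using True C by (intro add_increasing mult_left_mono) auto
      finally show ?thesis
        using norm_phi_le[OF less.prems(1)] \<psi>(2) norm_triangle_ineq4[of "\<phi> m" \<psi>] by linarith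
    next
      case False
      with n have m: "2 \<le> m" by simp
      have hm: "0 \<le> h m" unfolding h_def using C less.prems by simp
      let ?w = "\<lambda>k. complex_of_real (split_weight m k)"
      have "\<phi> m - \<psi> = of_real (1 - p) * ((\<Sum>k=1..<m. ?w k * (\<phi> k * \<phi> (m - k))) - c * \<psi>)"
        by (subst \<psi>(1), subst phi_rec[OF m]) (simp add: algebra_simps)
      \<comment> \<open>Subtracting \<psi> in the factor of the root part only leaves
        \<open>\<phi> k\<close> as a multiplier of modulus at most 1; its distance from 1, which may
        be large for large \<open>k\<close>, is seen through the average alone.\<close>
      also have "(\<Sum>k=1..<m. ?w k * (\<phi> k * \<phi> (m - k)))
          = (\<Sum>k=1..<m. ?w k * \<phi> k * (\<phi> (m - k) - \<psi>)) + (\<Sum>k=1..<m. ?w k * \<phi> k) * \<psi>"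
        by (simp add: sum_distrib_right right_diff_distrib sum_subtractf mult.assoc)
      also have "\<dots> - c * \<psi> = (\<Sum>k=1..<m. ?w k * \<phi> k * (\<phi> (m - k) - \<psi>)) + ((\<Sum>k=1..<m. ?w k * \<phi> k) - c) * \<psi>"
        by (simp add: algebra_simps)
      finally have "norm (\<phi> m - \<psi>) \<le> (1 - p) *
          (norm (\<Sum>k=1..<m. ?w k * \<phi> k * (\<phi> (m - k) - \<psi>)) + norm ((\<Sum>k=1..<m. ?w k * \<phi> k) - c) * norm \<psi>)"
        using p01 by (simp add: norm_mult mult_left_mono norm_triangle_le del: of_real_diff)
      also have "\<dots> \<le> (1 - p) * ((h m + 8 * ln (real n) / real n) + \<beta> * p * 1)"
      proof (intro mult_left_mono add_mono mult_mono)
        have "norm (\<Sum>k=1..<m. ?w k * \<phi> k * (\<phi> (m - k) - \<psi>)) \<le> (\<Sum>k=1..<m. split_weight m k * h (m - k))"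
        proof (intro sum_norm_le)
          fix k assume "k \<in> {1..<m}"
          then have k: "1 \<le> k" "k < m" by auto
          have "norm (?w k * \<phi> k * (\<phi> (m - k) - \<psi>)) = split_weight m k * (norm (\<phi> k) * norm (\<phi> (m - k) - \<psi>))"
            by (simp add: norm_mult)
          also have "\<dots> \<le> split_weight m k * (1 * h (m - k))"
            using k less by (intro mult_left_mono mult_mono norm_phi_le) auto
          finally show "norm (?w k * \<phi> k * (\<phi> (m - k) - \<psi>)) \<le> split_weight m k * h (m - k)" by simp
        qed
        also have "\<dots> = (\<Sum>k=1..<m. split_weight m k * h m + 4 / real n * (split_weight m k * real k))"
        proof (intro sum.cong refl)
          fix k assume "k \<in> {1..<m}"
          then have "h (m - k) = h m + 4 / real n * real k"
            by (simp add: h_def of_nat_diff algebra_simps add_divide_distrib diff_divide_distrib)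
          then show "split_weight m k * h (m - k) = split_weight m k * h m + 4 / real n * (split_weight m k * real k)"
            by (simp add: algebra_simps)
        qed
        also have "\<dots> = h m + 4 / real n * (\<Sum>k=1..<m. split_weight m k * real k)"
          using sum_split_weight[OF m]
          by (simp only: sum.distrib sum_distrib_left[symmetric] sum_distrib_right[symmetric] mult_1_left)
        also have "\<dots> \<le> h m + 4 / real n * (2 * ln (real n))"
          using split_weight_mean_le[OF m] m less.prems
          by (intro add_left_mono mult_left_mono order_trans[OF split_weight_mean_le[OF m]]) auto
        finally show "norm (\<Sum>k=1..<m. ?w k * \<phi> k * (\<phi> (m - k) - \<psi>)) \<le> h m + 8 * ln (real n) / real n"
          by simp
      qed (use p01 \<psi> avg[OF m] False less.prems \<beta> in auto)
      also have "8 * ln (real n) / real n = p * (C - \<beta>)"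
        using p by (simp add: C_def)
      also have "(1 - p) * ((h m + p * (C - \<beta>)) + \<beta> * p * 1) = (1 - p) * (h m + p * C)"
        by (simp add: algebra_simps)
      also have "\<dots> \<le> (1 - p) * h m + p * C"
        using p01 C by (simp add: algebra_simps)
      also have "\<dots> \<le> (1 - p) * h m + p * h m"
        using p01 less.prems by (intro add_left_mono mult_left_mono) (auto simp: h_def)
      also have "\<dots> = h m" by (simp add: algebra_simps)
      finally show ?thesis .
    qed
  qed
  from this[of n] n show ?thesis by (simp add: h_def C_def)
qed

lemma norm_phi_minus_limit_le:
  assumes p: "0 < p" and \<theta>: "\<theta> = t * p / ln (1 / p)"
    and L: "1 \<le> ln (1 / p)" and n: "2 \<le> n" "4 * (sqrt (ln (1 / p)) + 1) \<le> real n * p"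
  shows "norm (\<phi> n - 1 / (1 - \<i> * of_real (t * (1 - p)))) \<le>
    2 * ((\<bar>t\<bar> / ln (1 / p) + t\<^sup>2 / (ln (1 / p))\<^sup>2) * (sqrt (ln (1 / p)) + 1)
       + \<bar>t\<bar> * ((1 + ln (sqrt (ln (1 / p)) + 1)) / ln (1 / p)) + 2 / sqrt (ln (1 / p)))
    + 4 * \<bar>t\<bar> / real n + 8 * ln (real n) / (real n * p)"
proof -
  define L where "L = ln (1 / p)"
  \<comment> \<open>The cutoff needs \<open>p * N\<close> large, to make the tail
    \<open>2 / N\<close> small compared to \<open>p\<close>, and \<open>p * N / L\<close> small, to
    control the error of the linear approximation, \<theta> being of order \<open>p / L\<close>.
    Then \<open>ln N\<close> is asymptotic to \<open>L\<close>. The square root of \<open>L\<close>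
    meets both demands.\<close>
  define N where "N = nat \<lceil>sqrt L / p\<rceil>"
  \<comment> \<open>Fixed point for \<open>c = 1 + \<i> * t * p\<close>: here
    \<open>1 - (1 - p) * c = p * (1 - \<i> * t * (1 - p))\<close>, and a factor \<open>p\<close>
    cancels.\<close>
  define \<psi> where "\<psi> = 1 / (1 - \<i> * complex_of_real (t * (1 - p)))"
  define B where "B = (\<bar>t\<bar> / L + t\<^sup>2 / L\<^sup>2) * (sqrt L + 1) + \<bar>t\<bar> * ((1 + ln (sqrt L + 1)) / L) + 2 / sqrt L"
  have L1: "1 \<le> L" using L by (simp add: L_def)
  then have sL: "1 \<le> sqrt L" by simp
  have N1: "sqrt L / p \<le> real N" unfolding N_def by linarith
  have N2: "real N \<le> sqrt L / p + 1" 
  proof -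
    have "0 \<le> sqrt L / p" using sL p by simp
    then have "real N = of_int \<lceil>sqrt L / p\<rceil>" by (simp add: N_def)
    then show ?thesis using of_int_ceiling_le_add_one[of "sqrt L / p"] by simp
  qed
  have "1 \<le> 1 / p" using p p01 by simp
  then have N2': "real N \<le> (sqrt L + 1) / p" using N2 by (simp add: add_divide_distrib)
  have "1 / p \<le> sqrt L / p" using sL p by (intro divide_right_mono) auto
  with N1 have Np: "1 / p \<le> real N" by simp
  with \<open>1 \<le> 1 / p\<close> have "1 \<le> real N" by linarith
  then have N: "1 \<le> N" by simp
  have pN: "sqrt L \<le> p * real N" "p * real N \<le> sqrt L + 1"
    using N1 N2' p by (simp_all add: field_simps)
  \<comment> \<open>Keeps the cutoff below every size \<open>m > n / 2\<close> at which the average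
    is estimated.\<close>
  have nN: "4 * real N \<le> real n"
  proof -
    have "4 * (p * real N) \<le> real n * p" using pN n by (simp add: L_def)
    then show ?thesis using p by (simp add: field_simps)
  qed
  have harm: "\<bar>(harm N - 1) - L\<bar> \<le> 1 + ln (sqrt L + 1)"
  proof -
    have "L \<le> ln (real N)" unfolding L_def using Np p by (intro ln_mono) auto
    moreover have "ln (real N) \<le> ln (real N + 1)" using N by simp
    ultimately have 1: "- 1 \<le> (harm N - 1) - L" using harm_ge_ln[of N] by linarith
    have "ln (real N) \<le> ln ((sqrt L + 1) / p)" using N N2' p by (intro ln_mono) auto
    then have "ln (real N) \<le> ln (sqrt L + 1) + L"
    proof -
      have "0 < sqrt L + 1" using sL by linarith
      moreover have "L = - ln p" using p by (simp add: L_def ln_div)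
      ultimately show "ln (real N) \<le> ln (sqrt L + 1) + L"
        using p \<open>ln (real N) \<le> ln ((sqrt L + 1) / p)\<close> by (simp add: ln_div)
    qed
    then have "(harm N - 1) - L \<le> ln (sqrt L + 1)" using harm_le_ln[OF N] by linarith
    moreover have "0 \<le> ln (sqrt L + 1)" using sL by simp
    ultimately show ?thesis using 1 by linarith
  qed
  have err: "(\<bar>\<theta>\<bar> * p + \<theta>\<^sup>2) * real N + \<bar>\<theta> * (harm N - 1) - t * p\<bar> + 2 / real N \<le> p * B"
  proof -
    have "(\<bar>\<theta>\<bar> * p + \<theta>\<^sup>2) * real N = p * ((\<bar>t\<bar> / L + t\<^sup>2 / L\<^sup>2) * (p * real N))"
      using p L1 by (simp add: \<theta> abs_mult power2_eq_square field_simps flip: L_def)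
    also have "\<dots> \<le> p * ((\<bar>t\<bar> / L + t\<^sup>2 / L\<^sup>2) * (sqrt L + 1))"
      using pN p L1 by (intro mult_left_mono) auto
    finally have 1: "(\<bar>\<theta>\<bar> * p + \<theta>\<^sup>2) * real N \<le> p * ((\<bar>t\<bar> / L + t\<^sup>2 / L\<^sup>2) * (sqrt L + 1))" .
    have "\<theta> * (harm N - 1) - t * p = p * t * (((harm N - 1) - L) / L)"
      using L1 by (simp add: \<theta> flip: L_def) (simp add: field_simps)
    then have "\<bar>\<theta> * (harm N - 1) - t * p\<bar> = p * \<bar>t\<bar> * (\<bar>(harm N - 1) - L\<bar> / L)"
      using p L1 by (simp add: abs_mult)
    also have "\<dots> \<le> p * \<bar>t\<bar> * ((1 + ln (sqrt L + 1)) / L)"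
      using p L1 harm by (intro mult_left_mono divide_right_mono) auto
    finally have 2: "\<bar>\<theta> * (harm N - 1) - t * p\<bar> \<le> p * (\<bar>t\<bar> * ((1 + ln (sqrt L + 1)) / L))" by simp
    have "2 / real N \<le> 2 / (sqrt L / p)"
      using N1 sL p N by (intro divide_left_mono mult_pos_pos) auto
    then have "2 / real N \<le> p * (2 / sqrt L)" by (simp add: mult.commute)
    with 1 2 show ?thesis by (simp add: B_def distrib_left)
  qed
  have avg: "norm ((\<Sum>k=1..<m. of_real (split_weight m k) * \<phi> k) - (1 + \<i> * of_real (t * p)))
      \<le> (2 * B + 4 * \<bar>t\<bar> / real n) * p" if m: "2 \<le> m" "n < 2 * m" "m \<le> n" for m
  proof -
    have "2 * N < m" using nN m by linarith
    then have "norm ((\<Sum>k=1..<m. (\<phi> k - 1) / of_real (real k * (real k + 1))) - \<i> * of_real (t * p)) \<le> p * B"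
      using err by (intro order_trans[OF norm_sum_phi_le[OF N]]) auto
    from split_average_phi_le[OF m(1) this]
    have "norm ((\<Sum>k=1..<m. of_real (split_weight m k) * \<phi> k) - (1 + \<i> * of_real (t * p)))
      \<le> 2 * (p * B) + \<bar>t * p\<bar> / real (m - 1)" .
    also have "\<bar>t * p\<bar> / real (m - 1) \<le> \<bar>t * p\<bar> / (real n / 4)"
      using m n by (intro divide_left_mono) (auto simp: of_nat_diff)
    also have "2 * (p * B) + \<bar>t * p\<bar> / (real n / 4) = (2 * B + 4 * \<bar>t\<bar> / real n) * p"
      using p by (simp add: abs_mult algebra_simps)
    finally show ?thesis by simp
  qed
  have den: "1 \<le> norm (1 - \<i> * complex_of_real (t * (1 - p)))"
    using complex_Re_le_cmod[of "1 - \<i> * complex_of_real (t * (1 - p))"] by simp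
  have "norm (\<phi> n - \<psi>) \<le> (2 * B + 4 * \<bar>t\<bar> / real n) + 8 * ln (real n) / (real n * p)"
  proof (rule norm_phi_minus_fixed_point_le[OF p n(1) _ _ _ avg])
    have "1 - \<i> * complex_of_real (t * (1 - p)) \<noteq> 0" by (simp add: complex_eq_iff)
    then show "\<psi> = of_real p + of_real (1 - p) * (1 + \<i> * of_real (t * p)) * \<psi>"
      unfolding \<psi>_def by (simp add: field_simps)
    show "norm \<psi> \<le> 1" unfolding \<psi>_def using den by (simp add: norm_divide divide_le_eq_1)
    show "0 \<le> 2 * B + 4 * \<bar>t\<bar> / real n" unfolding B_def using L1 sL by simp
  qed
  then show ?thesis by (simp add: \<psi>_def B_def L_def)
qed

end

section \<open>Passage to the limit along the diagonal\<close>

lemma split_recursion_limit: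
  fixes p :: "nat \<Rightarrow> real" and \<phi> :: "nat \<Rightarrow> nat \<Rightarrow> complex"
  assumes rec: "\<And>n. 1 \<le> n \<Longrightarrow> split_recursion (\<phi> n) (p n) (t * p n / ln (1 / p n))"
    and p: "p \<longlonglongrightarrow> 0"
    and np: "filterlim (\<lambda>n. real n * p n / ln (real n)) at_top sequentially"
  shows "(\<lambda>n. \<phi> n n) \<longlonglongrightarrow> 1 / (1 - \<i> * of_real t)"
proof -
  define L where "L = (\<lambda>n. ln (1 / p n))"
  define B where "B = (\<lambda>L. 2 * ((\<bar>t\<bar> / L + t\<^sup>2 / L\<^sup>2) * (sqrt L + 1)
     + \<bar>t\<bar> * ((1 + ln (sqrt L + 1)) / L) + 2 / sqrt L))"
  define \<psi> where "\<psi> = (\<lambda>n. 1 / (1 - \<i> * complex_of_real (t * (1 - p n))))"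
  \<comment> \<open>The constant 8 makes \<open>n * p n\<close> at least
    \<open>4 * (sqrt (L n) + 1)\<close>, because \<open>sqrt (L n)\<close> and 1 are both eventually
    at most \<open>ln n\<close>.\<close>
  have ge: "eventually (\<lambda>n. 8 \<le> real n * p n / ln (real n)) sequentially"
    using np unfolding filterlim_at_top by blast
  have large: "eventually (\<lambda>n. 3 \<le> n) sequentially" by (rule eventually_ge_at_top)
  have lnn: "1 \<le> ln (real n)" if "3 \<le> n" for n
  proof -
    have "exp 1 \<le> real n" using e_less_272 that by linarith
    then show ?thesis using that by (simp add: ln_ge_iff)
  qed
  have npn: "eventually (\<lambda>n. 3 \<le> n \<and> 8 * ln (real n) \<le> real n * p n) sequentially"
    using ge large
  proof eventually_elim
    case (elim n)
    with lnn[of n] show ?case by (simp add: pos_le_divide_eq)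
  qed
  have pos: "eventually (\<lambda>n. 0 < p n) sequentially"
    using npn
  proof eventually_elim
    case (elim n)
    then have "0 < real n * p n" using lnn[of n] by linarith
    with elim show ?case by (simp add: zero_less_mult_iff)
  qed
  have "filterlim p (at_right 0) sequentially"
    using p pos by (auto simp: filterlim_at eventually_mono)
  then have L: "filterlim L at_top sequentially"
    unfolding L_def by (rule filterlim_compose[rotated]) real_asymp
  have lims: "((\<lambda>L. (sqrt L + 1) / L) \<longlongrightarrow> 0) at_top" "((\<lambda>L. (sqrt L + 1) / L\<^sup>2) \<longlongrightarrow> 0) at_top"
    "((\<lambda>L. (1 + ln (sqrt L + 1)) / L) \<longlongrightarrow> 0) at_top" "((\<lambda>L. 2 / sqrt L) \<longlongrightarrow> 0) at_top"
    by real_asymp+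
  have "((\<lambda>L. 2 * ((\<bar>t\<bar> * ((sqrt L + 1) / L) + t\<^sup>2 * ((sqrt L + 1) / L\<^sup>2))
     + \<bar>t\<bar> * ((1 + ln (sqrt L + 1)) / L) + 2 / sqrt L)) \<longlongrightarrow> 2 * ((\<bar>t\<bar> * 0 + t\<^sup>2 * 0) + \<bar>t\<bar> * 0 + 0)) at_top"
    by (intro tendsto_mult_left tendsto_add lims)
  then have "(B \<longlongrightarrow> 0) at_top"
    by (simp add: B_def algebra_simps)
  then have BL: "(\<lambda>n. B (L n)) \<longlonglongrightarrow> 0"
    by (rule filterlim_compose) (rule L)
  have L1: "eventually (\<lambda>n. 1 \<le> L n) sequentially"
    using L unfolding filterlim_at_top by blast
  have bound: "eventually (\<lambda>n. norm (\<phi> n n - \<psi> n) \<le> B (L n) + 4 * \<bar>t\<bar> / real n + 8 * inverse (real n * p n / ln (real n))) sequentially"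
    using npn pos L1
  proof eventually_elim
    case (elim n)
    interpret split_recursion "\<phi> n" "p n" "t * p n / ln (1 / p n)"
      using elim by (intro rec) auto
    have l: "1 \<le> ln (real n)" using lnn elim by simp
    then have "1 / p n \<le> real n" using elim by (simp add: field_simps)
    then have "L n \<le> ln (real n)" unfolding L_def using elim by (intro ln_mono) auto
    moreover have "sqrt (L n) \<le> L n" using elim by (intro real_le_lsqrt) (auto simp: power2_eq_square)
    ultimately have "4 * (sqrt (L n) + 1) \<le> 8 * ln (real n)" using l by argo
    also have "\<dots> \<le> real n * p n" using elim by simp
    finally have "4 * (sqrt (L n) + 1) \<le> real n * p n" .
    then have "norm (\<phi> n n - \<psi> n) \<le> B (L n) + 4 * \<bar>t\<bar> / real n + 8 * ln (real n) / (real n * p n)"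
      unfolding B_def L_def \<psi>_def using elim by (intro norm_phi_minus_limit_le) (auto simp: L_def)
    moreover have "8 * ln (real n) / (real n * p n) = 8 * inverse (real n * p n / ln (real n))"
      by (simp only: inverse_divide times_divide_eq_right)
    ultimately show ?case by (simp only:)
  qed
  have "(\<lambda>n. B (L n) + 4 * \<bar>t\<bar> / real n + 8 * inverse (real n * p n / ln (real n))) \<longlonglongrightarrow> 0 + 0 + 8 * 0"
    by (rule tendsto_add[OF tendsto_add[OF BL lim_const_over_n]
          tendsto_mult[OF tendsto_const tendsto_inverse_0_at_top[OF np]]])
  then have "(\<lambda>n. \<phi> n n - \<psi> n) \<longlonglongrightarrow> 0"
    by (intro Lim_null_comparison[OF bound]) (simp only: add_0_left mult_zero_right)
  moreover have "1 - \<i> * complex_of_real (t * (1 - 0)) \<noteq> 0"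
    by (simp add: complex_eq_iff)
  then have "\<psi> \<longlonglongrightarrow> 1 / (1 - \<i> * of_real (t * (1 - 0)))"
    unfolding \<psi>_def by (intro tendsto_intros p)
  ultimately have "(\<lambda>n. (\<phi> n n - \<psi> n) + \<psi> n) \<longlonglongrightarrow> 0 + 1 / (1 - \<i> * of_real (t * (1 - 0)))"
    by (rule tendsto_add)
  then show ?thesis by simp
qed

section \<open>The exponential distribution\<close>

lemma real_distribution_exponential:
  "0 < l \<Longrightarrow> real_distribution (density lborel (\<lambda>x. ennreal (exponential_density l x)))"
  by (simp add: real_distribution_def real_distribution_axioms_def prob_space_exponential_density)

text \<open>The integrand \<open>exp ((\<i> * t - 1) * x)\<close> on the half line has an explicit
  antiderivative, which vanishes at infinity because its modulus is a multiple of
  \<open>exp (- x)\<close>.\<close>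

lemma char_exponential:
  "char (density lborel (\<lambda>x. ennreal (exponential_density 1 x))) t = 1 / (1 - \<i> * of_real t)"
proof -
  let ?M = "density lborel (\<lambda>x. ennreal (exponential_density 1 x))"
  let ?c = "\<i> * of_real t - 1"
  let ?f = "\<lambda>x. exp (?c * complex_of_real x)"
  interpret real_distribution ?M by (rule real_distribution_exponential) simp
  have c: "?c \<noteq> 0" by (simp add: complex_eq_iff)
  have nonneg: "AE x in lborel. 0 \<le> exponential_density 1 x"
    by (simp add: exponential_density_nonneg)
  \<comment> \<open>Almost everywhere only: the density is 1 at 0, while
    \<open>einterval 0 \<infinity>\<close> is open.\<close>
  have eq: "AE x in lborel. exponential_density 1 x *\<^sub>R iexp (t * x) = indicator (einterval 0 \<infinity>) x *\<^sub>R ?f x"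
    using AE_lborel_singleton[of 0]
  proof eventually_elim
    case (elim x)
    then show ?case
      by (auto simp: exponential_density_def einterval_def zero_ereal_def scaleR_conv_of_real
          algebra_simps exp_minus exp_diff divide_inverse simp flip: exp_of_real split: split_indicator)
  qed
  have meas: "(\<lambda>x. iexp (t * x)) \<in> borel_measurable lborel" by measurable
  have "integrable ?M (\<lambda>x. iexp (t * x))"
    using integrable_iexp[of "\<lambda>x. of_real (t * x)"] by simp
  then have "integrable lborel (\<lambda>x. exponential_density 1 x *\<^sub>R iexp (t * x))"
    using integrable_density[OF meas _ nonneg] by simp
  then have int: "set_integrable lborel (einterval 0 \<infinity>) ?f"
    unfolding set_integrable_def by (rule integrable_cong_AE_imp[OF _ _ eq]) measurable
  have "char ?M t = (\<integral>x. exponential_density 1 x *\<^sub>R iexp (t * x) \<partial>lborel)"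
    unfolding char_def by (rule integral_density[OF meas _ nonneg]) measurable
  also have "\<dots> = (\<integral>x. indicator (einterval 0 \<infinity>) x *\<^sub>R ?f x \<partial>lborel)"
    by (intro integral_cong_AE eq) measurable
  also have "\<dots> = (LBINT x=0..\<infinity>. ?f x)"
    by (simp add: interval_lebesgue_integral_def set_lebesgue_integral_def)
  also have "\<dots> = 0 - 1 / ?c"
  proof (rule interval_integral_FTC_integrable[where F = "\<lambda>x. ?f x / ?c"])
    show "((\<lambda>x. ?f x / ?c) has_vector_derivative ?f x) (at x)" for x
    proof -
      have "((\<lambda>z. exp (?c * z) / ?c) has_field_derivative ?f x) (at (of_real x))"
        using c by (auto intro!: derivative_eq_intros)
      from has_vector_derivative_real_field[OF this] show ?thesis .
    qed
    show "isCont ?f x" for x by (intro continuous_intros)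
    have "((\<lambda>x. ?f x / ?c) \<longlongrightarrow> ?f 0 / ?c) (at_right 0)"
      by (intro tendsto_intros c)
    then show "(((\<lambda>x. ?f x / ?c) \<circ> real_of_ereal) \<longlongrightarrow> 1 / ?c) (at_right 0)"
      by (simp add: zero_ereal_def ereal_tendsto_simps)
    have "((\<lambda>x. exp (- x) / norm ?c) \<longlongrightarrow> 0 / norm ?c) at_top"
      using c by (intro tendsto_divide tendsto_const filterlim_compose[OF exp_at_bot filterlim_uminus_at_bot_at_top]) simp
    then have "((\<lambda>x. norm (?f x / ?c)) \<longlongrightarrow> 0) at_top"
      by (simp add: norm_divide)
    then have "((\<lambda>x. ?f x / ?c) \<longlongrightarrow> 0) at_top"
      by (simp only: tendsto_norm_zero_iff)
    then show "(((\<lambda>x. ?f x / ?c) \<circ> real_of_ereal) \<longlongrightarrow> 0) (at_left \<infinity>)"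
      by (simp only: ereal_tendsto_simps)
  qed (use int in simp_all)
  also have "\<dots> = 1 / (1 - \<i> * of_real t)"
    using c by (simp add: minus_divide_right)
  finally show ?thesis .
qed

section \<open>Fire dynamics on a fixed tree\<close>

lemma finite_set_pmf_fire_step: "finite (set_pmf (fire_step E p s e))"
  by (simp add: fire_step_def)

lemma finite_set_pmf_fire_run: "finite (set_pmf (fire_run E p s es))"
  by (induction es arbitrary: s) (auto simp: finite_set_pmf_fire_step)

definition burn :: "'a set set \<Rightarrow> ('a set \<Rightarrow> edge_state) \<Rightarrow> 'a set \<Rightarrow> 'a set \<Rightarrow> edge_state" where
  "burn E s e = (\<lambda>f. if f \<in> fire_cluster E s e then Burnt else s f)"

text \<open>Fires spread in \<open>E\<close>, while \<open>R\<close> holds the edges still to be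
  considered, from an arbitrary state \<open>s\<close>. With both sets as parameters the family is
  closed under considering one edge.\<close>

definition fire_mean ::
  "'a set set \<Rightarrow> real \<Rightarrow> 'a set set \<Rightarrow> ('a set \<Rightarrow> edge_state) \<Rightarrow> (('a set \<Rightarrow> edge_state) \<Rightarrow> complex) \<Rightarrow> complex" where
  "fire_mean E p R s g =
     measure_pmf.expectation (bind_pmf (pmf_of_set (permutations_of_set R)) (fire_run E p s)) g"

definition fire_step_mean ::
  "'a set set \<Rightarrow> real \<Rightarrow> 'a set set \<Rightarrow> ('a set \<Rightarrow> edge_state) \<Rightarrow> (('a set \<Rightarrow> edge_state) \<Rightarrow> complex) \<Rightarrow> 'a set \<Rightarrow> complex" where
  "fire_step_mean E p R s g e =
     (if s e = Burnt then fire_mean E p (R - {e}) s g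
      else of_real p * fire_mean E p (R - {e}) (burn E s e) g
         + of_real (1 - p) * fire_mean E p (R - {e}) (s(e := Fireproof)) g)"

lemma fire_mean_empty [simp]: "fire_mean E p {} s g = g s"
  by (simp add: fire_mean_def pmf_of_set_singleton bind_return_pmf)

text \<open>A uniform permutation of \<open>R\<close> is a uniform first edge followed by a uniform
  permutation of the others. The latter is independent of the coin of the first step, so the two
  draws can be interchanged.\<close>

lemma fire_mean_rec:
  assumes "finite R" "R \<noteq> {}" "0 \<le> p" "p \<le> 1"
  shows "fire_mean E p R s g = (\<Sum>e\<in>R. fire_step_mean E p R s g e) / of_nat (card R)"
proof -
  let ?perm = "\<lambda>R. pmf_of_set (permutations_of_set R)"
  have fin: "finite (set_pmf (?perm (R - {e}) \<bind> fire_run E p s'))" for e s'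
    using assms by (auto simp: finite_set_pmf_fire_run)
  have step: "measure_pmf.expectation (fire_step E p s e \<bind> (\<lambda>s'. ?perm (R - {e}) \<bind> fire_run E p s')) g
      = fire_step_mean E p R s g e" for e
  proof (cases "s e = Burnt")
    case True
    then show ?thesis
      by (simp add: fire_step_def fire_step_mean_def fire_mean_def bind_return_pmf)
  next
    case False
    then show ?thesis using assms
      unfolding fire_step_def fire_step_mean_def fire_mean_def bind_map_pmf burn_def if_not_P[OF False]
      by (subst pmf_expectation_bind[of UNIV]) (auto simp: UNIV_bool scaleR_conv_of_real finite_set_pmf_fire_run)
  qed
  have "?perm R \<bind> fire_run E p s
      = pmf_of_set R \<bind> (\<lambda>e. ?perm (R - {e}) \<bind> (\<lambda>es. fire_step E p s e \<bind> (\<lambda>s'. fire_run E p s' es)))"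
    using assms by (simp add: random_permutation_of_set bind_assoc_pmf bind_return_pmf)
  also have "\<dots> = pmf_of_set R \<bind> (\<lambda>e. fire_step E p s e \<bind> (\<lambda>s'. ?perm (R - {e}) \<bind> fire_run E p s'))"
    by (subst bind_commute_pmf) simp
  finally have eq: "?perm R \<bind> fire_run E p s
      = pmf_of_set R \<bind> (\<lambda>e. fire_step E p s e \<bind> (\<lambda>s'. ?perm (R - {e}) \<bind> fire_run E p s'))" .
  have "fire_mean E p R s g = (\<Sum>e\<in>R. fire_step_mean E p R s g e /\<^sub>R real (card R))"
    unfolding fire_mean_def eq using assms
    by (subst pmf_expectation_bind_pmf_of_set) (auto simp: step finite_set_pmf_fire_step finite_set_pmf_fire_run)
  then show ?thesis
    by (simp add: scaleR_conv_of_real divide_inverse sum_distrib_left mult.commute)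
qed

lemma fire_run_burnt: "(\<And>e. e \<in> set es \<Longrightarrow> s e = Burnt) \<Longrightarrow> fire_run E p s es = return_pmf s"
  by (induction es) (auto simp: fire_step_def bind_return_pmf)

lemma fire_mean_burnt:
  assumes "finite R" "\<And>e. e \<in> R \<Longrightarrow> s e = Burnt"
  shows "fire_mean E p R s g = g s"
proof -
  have "pmf_of_set (permutations_of_set R) \<bind> fire_run E p s
      = pmf_of_set (permutations_of_set R) \<bind> (\<lambda>_. return_pmf s)"
    using assms by (intro bind_pmf_cong refl fire_run_burnt) (auto dest: permutations_of_setD)
  then show ?thesis by (simp add: fire_mean_def)
qed

lemma fire_run_fireproof:
  "s e = Fireproof \<Longrightarrow> e \<notin> set es \<Longrightarrow> s' \<in> set_pmf (fire_run E p s es) \<Longrightarrow> s' e = Fireproof"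
proof (induction es arbitrary: s)
  case (Cons x es)
  \<comment> \<open>Every member of a cluster besides its origin \<open>x\<close> is flammable, so
    no fire reaches a fireproof edge.\<close>
  have "e \<notin> fire_cluster E s x"
    using Cons.prems by (auto simp: fire_cluster_def elim: rtranclE)
  then have "s'' e = Fireproof" if "s'' \<in> set_pmf (fire_step E p s x)" for s''
    using that Cons.prems by (auto simp: fire_step_def split: if_splits)
  then show ?case using Cons by auto
qed simp

text \<open>Since \<open>e\<close> stays fireproof, an observable may be replaced by one that agrees
  with it only on states where \<open>e\<close> is fireproof; in this way the fireproof count is
  split over the two parts.\<close>

lemma fire_mean_fireproof:
  assumes "finite R" "s e = Fireproof" "e \<notin> R"
    and eq: "\<And>s. s e = Fireproof \<Longrightarrow> g s = g' s"
  shows "fire_mean E p R s g = fire_mean E p R s g'"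
proof -
  let ?D = "pmf_of_set (permutations_of_set R) \<bind> fire_run E p s"
  have "g s' = g' s'" if s': "s' \<in> set_pmf ?D" for s'
  proof -
    from s' assms(1) obtain es where "es \<in> permutations_of_set R" "s' \<in> set_pmf (fire_run E p s es)"
      by auto
    then have "s' e = Fireproof"
      using assms(2,3) by (intro fire_run_fireproof[of s e es s' E p]) (auto dest: permutations_of_setD)
    then show ?thesis by (rule eq)
  qed
  then have "AE s' in ?D. g s' = g' s'" unfolding AE_measure_pmf_iff by blast
  then show ?thesis
    unfolding fire_mean_def by (intro integral_cong_AE) simp_all
qed

section \<open>Independence of the dynamics on separated edge sets\<close>

definition depends_on :: "'b set \<Rightarrow> (('b \<Rightarrow> 'c) \<Rightarrow> 'd) \<Rightarrow> bool" where
  "depends_on A g \<longleftrightarrow> (\<forall>s s'. (\<forall>x\<in>A. s x = s' x) \<longrightarrow> g s = g s')"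

lemma fire_cluster_cong:
  assumes "\<And>f. f \<in> E \<Longrightarrow> s f = s' f"
  shows "fire_cluster E s e = fire_cluster E s' e"
proof -
  have "{(f, g). f \<in> E \<and> g \<in> E \<and> s f = Flammable \<and> s g = Flammable \<and> f \<inter> g \<noteq> {}}
      = {(f, g). f \<in> E \<and> g \<in> E \<and> s' f = Flammable \<and> s' g = Flammable \<and> f \<inter> g \<noteq> {}}"
    using assms by auto
  then show ?thesis by (simp add: fire_cluster_def)
qed

lemma fire_mean_cong:
  assumes "finite R" "R \<subseteq> E" "0 \<le> p" "p \<le> 1" "depends_on E g" "\<And>f. f \<in> E \<Longrightarrow> s f = s' f"
  shows "fire_mean E p R s g = fire_mean E p R s' g"
  using assms(1,2,6)
proof (induction R arbitrary: s s' rule: finite_psubset_induct)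
  case (psubset R)
  show ?case
  proof (cases "R = {}")
    case True
    then show ?thesis using assms(5) psubset.prems by (auto simp: depends_on_def)
  next
    case False
    have "fire_step_mean E p R s g e = fire_step_mean E p R s' g e" if "e \<in> R" for e
    proof -
      have R: "R - {e} \<subset> R" "R - {e} \<subseteq> E" "e \<in> E" using that psubset.prems by auto
      note IH = psubset.IH[OF R(1,2)]
      have "fire_mean E p (R - {e}) s g = fire_mean E p (R - {e}) s' g"
        using psubset.prems by (intro IH)
      moreover have "fire_mean E p (R - {e}) (burn E s e) g = fire_mean E p (R - {e}) (burn E s' e) g"
        using psubset.prems by (intro IH) (auto simp: burn_def fire_cluster_cong[of E s s'])
      moreover have "fire_mean E p (R - {e}) (s(e := Fireproof)) g = fire_mean E p (R - {e}) (s'(e := Fireproof)) g"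
        using psubset.prems by (intro IH) auto
      ultimately show ?thesis
        using psubset.prems(2)[OF R(3)] by (simp add: fire_step_mean_def)
    qed
    then show ?thesis
      using psubset.hyps False assms by (simp add: fire_mean_rec)
  qed
qed

text \<open>No fire lit in \<open>A\<close> leaves it. As the condition concerns flammable edges
  \<open>g\<close> alone, it persists when the set of flammable edges shrinks.\<close>

definition fire_closed :: "'a set set \<Rightarrow> ('a set \<Rightarrow> edge_state) \<Rightarrow> 'a set set \<Rightarrow> bool" where
  "fire_closed E s A \<longleftrightarrow> A \<subseteq> E \<and> (\<forall>f\<in>A. \<forall>g\<in>E. s g = Flammable \<and> f \<inter> g \<noteq> {} \<longrightarrow> g \<in> A)"

lemma fire_cluster_closed:
  assumes "fire_closed E s A" "e \<in> A"
  shows "fire_cluster E s e = fire_cluster A s e" "fire_cluster E s e \<subseteq> A"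
proof -
  let ?r = "\<lambda>E. {(f, g). f \<in> E \<and> g \<in> E \<and> s f = Flammable \<and> s g = Flammable \<and> f \<inter> g \<noteq> {}}"
  have *: "(e, f) \<in> (?r A)\<^sup>* \<and> f \<in> A" if "(e, f) \<in> (?r E)\<^sup>*" for f
    using that
  proof (induction rule: rtrancl_induct)
    case (step f g)
    then have "(f, g) \<in> ?r A" using assms(1) unfolding fire_closed_def by blast
    with step.IH show ?case by (auto intro: rtrancl_into_rtrancl)
  qed (use assms in simp)
  have "(?r A)\<^sup>* \<subseteq> (?r E)\<^sup>*"
    using assms(1) by (intro rtrancl_mono) (auto simp: fire_closed_def)
  with * show "fire_cluster E s e = fire_cluster A s e" "fire_cluster E s e \<subseteq> A"
    unfolding fire_cluster_def by blast+
qed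

lemma fire_closed_mono:
  "fire_closed E s A \<Longrightarrow> (\<And>f. s' f = Flammable \<Longrightarrow> s f = Flammable) \<Longrightarrow> fire_closed E s' A"
  unfolding fire_closed_def by blast

text \<open>Instead of decomposing a shuffle of two orders, one conditions on the first edge
  considered. If it lies in \<open>R1\<close>, induction gives a first step of the left factor times
  the untouched right factor; these terms sum to \<open>card R1\<close> times the product, and
  symmetrically for \<open>R2\<close>. The two multiplicities add up to
  \<open>card (R1 \<union> R2)\<close>.\<close>

lemma fire_mean_mult:
  assumes fin: "finite R1" "finite R2" and p: "0 \<le> p" "p \<le> 1"
    and R: "R1 \<subseteq> A1" "R2 \<subseteq> A2" and disj: "A1 \<inter> A2 = {}"
    and closed: "fire_closed E s A1" "fire_closed E s A2"
    and g: "depends_on A1 g1" "depends_on A2 g2"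
  shows "fire_mean E p (R1 \<union> R2) s (\<lambda>s. g1 s * g2 s) = fire_mean A1 p R1 s g1 * fire_mean A2 p R2 s g2"
  using fin R closed
proof (induction "card (R1 \<union> R2)" arbitrary: R1 R2 s rule: less_induct)
  case less
  let ?g = "\<lambda>s. g1 s * g2 s"
  have step1: "fire_step_mean E p (R1 \<union> R2) s ?g e = fire_step_mean A1 p R1 s g1 e * fire_mean A2 p R2 s g2"
    if e: "e \<in> R1" for e
  proof -
    have eA: "e \<in> A1" "e \<notin> A2" "e \<notin> R2" using e less.prems disj by auto
    have "fire_mean E p ((R1 \<union> R2) - {e}) s' ?g = fire_mean A1 p (R1 - {e}) s' g1 * fire_mean A2 p R2 s g2"
      if s': "\<And>f. f \<in> A2 \<Longrightarrow> s' f = s f" "\<And>f. s' f = Flammable \<Longrightarrow> s f = Flammable" for s'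
    proof -
      have "(R1 \<union> R2) - {e} = (R1 - {e}) \<union> R2" using eA by auto
      moreover have "card ((R1 - {e}) \<union> R2) < card (R1 \<union> R2)"
        using less.prems e eA by (intro psubset_card_mono) auto
      then have "fire_mean E p ((R1 - {e}) \<union> R2) s' ?g = fire_mean A1 p (R1 - {e}) s' g1 * fire_mean A2 p R2 s' g2"
        using less.prems s' by (intro less.hyps) (auto intro: fire_closed_mono)
      moreover have "fire_mean A2 p R2 s' g2 = fire_mean A2 p R2 s g2"
        using less.prems p g s' by (intro fire_mean_cong) auto
      ultimately show ?thesis by simp
    qed
    note * = this
    have cl: "fire_cluster E s e = fire_cluster A1 s e" "fire_cluster E s e \<subseteq> A1"
      using fire_cluster_closed[OF less.prems(5) eA(1)] by auto
    have "fire_mean E p ((R1 \<union> R2) - {e}) (burn E s e) ?g = fire_mean A1 p (R1 - {e}) (burn A1 s e) g1 * fire_mean A2 p R2 s g2"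
      using cl disj by (subst *) (auto simp: burn_def split: if_splits)
    moreover have "fire_mean E p ((R1 \<union> R2) - {e}) (s(e := Fireproof)) ?g = fire_mean A1 p (R1 - {e}) (s(e := Fireproof)) g1 * fire_mean A2 p R2 s g2"
      using eA by (intro *) (auto split: if_splits)
    moreover have "fire_mean E p ((R1 \<union> R2) - {e}) s ?g = fire_mean A1 p (R1 - {e}) s g1 * fire_mean A2 p R2 s g2"
      by (intro *) auto
    ultimately show ?thesis by (simp add: fire_step_mean_def algebra_simps)
  qed
  have step2: "fire_step_mean E p (R1 \<union> R2) s ?g e = fire_mean A1 p R1 s g1 * fire_step_mean A2 p R2 s g2 e"
    if e: "e \<in> R2" for e
  proof -
    have eA: "e \<in> A2" "e \<notin> A1" "e \<notin> R1" using e less.prems disj by auto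
    have "fire_mean E p ((R1 \<union> R2) - {e}) s' ?g = fire_mean A1 p R1 s g1 * fire_mean A2 p (R2 - {e}) s' g2"
      if s': "\<And>f. f \<in> A1 \<Longrightarrow> s' f = s f" "\<And>f. s' f = Flammable \<Longrightarrow> s f = Flammable" for s'
    proof -
      have "(R1 \<union> R2) - {e} = R1 \<union> (R2 - {e})" using eA by auto
      moreover have "card (R1 \<union> (R2 - {e})) < card (R1 \<union> R2)"
        using less.prems e eA by (intro psubset_card_mono) auto
      then have "fire_mean E p (R1 \<union> (R2 - {e})) s' ?g = fire_mean A1 p R1 s' g1 * fire_mean A2 p (R2 - {e}) s' g2"
        using less.prems s' by (intro less.hyps) (auto intro: fire_closed_mono)
      moreover have "fire_mean A1 p R1 s' g1 = fire_mean A1 p R1 s g1"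
        using less.prems p g s' by (intro fire_mean_cong) auto
      ultimately show ?thesis by simp
    qed
    note * = this
    have cl: "fire_cluster E s e = fire_cluster A2 s e" "fire_cluster E s e \<subseteq> A2"
      using fire_cluster_closed[OF less.prems(6) eA(1)] by auto
    have "fire_mean E p ((R1 \<union> R2) - {e}) (burn E s e) ?g = fire_mean A1 p R1 s g1 * fire_mean A2 p (R2 - {e}) (burn A2 s e) g2"
      using cl disj by (subst *) (auto simp: burn_def split: if_splits)
    moreover have "fire_mean E p ((R1 \<union> R2) - {e}) (s(e := Fireproof)) ?g = fire_mean A1 p R1 s g1 * fire_mean A2 p (R2 - {e}) (s(e := Fireproof)) g2"
      using eA by (intro *) (auto split: if_splits)
    moreover have "fire_mean E p ((R1 \<union> R2) - {e}) s ?g = fire_mean A1 p R1 s g1 * fire_mean A2 p (R2 - {e}) s g2"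
      by (intro *) auto
    ultimately show ?thesis by (simp add: fire_step_mean_def algebra_simps)
  qed
  have sum_step: "(\<Sum>e\<in>R. fire_step_mean A p R s g e) = of_nat (card R) * fire_mean A p R s g"
    if "finite R" for A R g
    using fire_mean_rec[OF that _ p, of A s g] that by (cases "R = {}") auto
  show ?case
  proof (cases "R1 \<union> R2 = {}")
    case False
    have "R1 \<inter> R2 = {}" using less.prems disj by blast
    then have card: "card (R1 \<union> R2) = card R1 + card R2"
      using less.prems by (intro card_Un_disjoint) auto
    have "(\<Sum>e\<in>R1 \<union> R2. fire_step_mean E p (R1 \<union> R2) s ?g e)
        = (\<Sum>e\<in>R1. fire_step_mean A1 p R1 s g1 e * fire_mean A2 p R2 s g2)
        + (\<Sum>e\<in>R2. fire_mean A1 p R1 s g1 * fire_step_mean A2 p R2 s g2 e)"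
      using less.prems \<open>R1 \<inter> R2 = {}\<close> by (simp add: sum.union_disjoint step1 step2)
    also have "\<dots> = of_nat (card (R1 \<union> R2)) * (fire_mean A1 p R1 s g1 * fire_mean A2 p R2 s g2)"
      using less.prems
      by (simp add: card sum_step algebra_simps flip: sum_distrib_left sum_distrib_right)
    finally show ?thesis
      using False less.prems p
      by (subst fire_mean_rec) (auto simp del: of_nat_add simp: card_eq_0_iff)
  qed simp
qed

section \<open>The first-edge recursion on a fixed tree\<close>

definition fireproof_char :: "real \<Rightarrow> real \<Rightarrow> 'a set \<Rightarrow> 'a set set \<Rightarrow> complex" where
  "fireproof_char p \<theta> V E =
     fire_mean E p E (\<lambda>_. Flammable) (\<lambda>s. cis (real (card (fireproof_vertices V E s)) * \<theta>))"

lemma fireproof_char_single [simp]: "fireproof_char p \<theta> {v} {} = cis \<theta>"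
  by (simp add: fireproof_char_def fireproof_vertices_def)

lemma fire_mean_split:
  assumes E: "finite E" "{} \<notin> E" "e \<in> E" "E - {e} = A \<union> B"
    and A: "A \<subseteq> Pow VA" "B \<subseteq> Pow VB" "VA \<inter> VB = {}" "V = VA \<union> VB" "finite V"
    and p: "0 \<le> p" "p \<le> 1"
  shows "fire_mean E p (E - {e}) ((\<lambda>_. Flammable)(e := Fireproof)) (\<lambda>s. cis (real (card (fireproof_vertices V E s)) * \<theta>))
    = fireproof_char p \<theta> VA A * fireproof_char p \<theta> VB B"
proof -
  let ?G = "\<lambda>V E s. cis (real (card (fireproof_vertices V E s)) * \<theta>)"
  let ?s = "(\<lambda>_. Flammable)(e := Fireproof)"
  have nonempty: "f \<noteq> {}" if "f \<in> A \<union> B" for f using that E by blast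
  have dep: "depends_on E (?G V E)" for V :: "'a set" and E
  proof -
    have "fireproof_vertices V E s = fireproof_vertices V E s'" if "\<forall>f\<in>E. s f = s' f" for s s'
      using that by (auto simp: fireproof_vertices_def)
    then show ?thesis unfolding depends_on_def by metis
  qed
  \<comment> \<open>Restricted to states where \<open>e\<close> is fireproof: otherwise the vertices
    of \<open>e\<close> drop out of the count in \<open>E\<close>, but possibly not out of the
    counts in the parts.\<close>
  have G: "?G V E s = ?G VA A s * ?G VB B s" if "s e = Fireproof" for s
  proof -
    have EE: "E = insert e (A \<union> B)" using E by blast
    have "fireproof_vertices V E s = fireproof_vertices VA A s \<union> fireproof_vertices VB B s"
      using A that unfolding EE fireproof_vertices_def by blast
    moreover have "fireproof_vertices VA A s \<inter> fireproof_vertices VB B s = {}"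
      using A by (auto simp: fireproof_vertices_def)
    moreover have "finite (fireproof_vertices VA A s)" "finite (fireproof_vertices VB B s)"
      using A by (auto simp: fireproof_vertices_def)
    ultimately show ?thesis
      by (simp add: card_Un_disjoint cis_mult algebra_simps)
  qed
  have "fire_mean E p (E - {e}) ?s (?G V E) = fire_mean E p (E - {e}) ?s (\<lambda>s. ?G VA A s * ?G VB B s)"
    by (rule fire_mean_fireproof[of _ _ e, OF _ _ _ G]) (simp_all add: E(1))
  also have "\<dots> = fire_mean A p A ?s (?G VA A) * fire_mean B p B ?s (?G VB B)"
    unfolding E(4)
  proof (rule fire_mean_mult)
    have flam: "f \<in> A \<union> B" if "f \<in> E" "?s f = Flammable" for f
      using that E(4) by (auto split: if_splits)
    have cross: "f \<inter> g = {}" if "f \<in> A" "g \<in> B" for f g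
    proof -
      have "f \<subseteq> VA" "g \<subseteq> VB" using that A by auto
      then show ?thesis using A(3) by blast
    qed
    show "A \<inter> B = {}" using cross nonempty by blast
    have sub: "A \<subseteq> E" "B \<subseteq> E" using E(4) by auto
    have "g \<in> A" if "f \<in> A" "g \<in> E" "?s g = Flammable \<and> f \<inter> g \<noteq> {}" for f g
      using flam[of g] cross[of f g] that by auto
    then show "fire_closed E ?s A"
      using sub(1) unfolding fire_closed_def by fast
    have "g \<in> B" if "f \<in> B" "g \<in> E" "?s g = Flammable \<and> f \<inter> g \<noteq> {}" for f g
      using flam[of g] cross[of g f] that by (auto simp: Int_commute)
    then show "fire_closed E ?s B"
      using sub(2) unfolding fire_closed_def by fast
    have "finite (A \<union> B)" using E by (metis finite_Diff)
    then show "finite A" "finite B" by auto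
  qed (use p dep in auto)
  also have "fire_mean A p A ?s (?G VA A) = fireproof_char p \<theta> VA A"
    unfolding fireproof_char_def using E p dep by (intro fire_mean_cong) (auto intro: finite_subset[of A E])
  also have "fire_mean B p B ?s (?G VB B) = fireproof_char p \<theta> VB B"
    unfolding fireproof_char_def using E p dep by (intro fire_mean_cong) (auto intro: finite_subset[of B E])
  finally show ?thesis .
qed

text \<open>If the first edge burns, so does its cluster, here all of \<open>E\<close>; as every
  vertex lies on an edge, none is fireproof and the value is \<open>cis 0 = 1\<close>. This is the
  origin of the summand \<open>p\<close>.\<close>

lemma fireproof_char_rec:
  assumes E: "finite E" "E \<noteq> {}" "{} \<notin> E" "V \<subseteq> \<Union>E" "finite V"
    and connected: "\<And>e. e \<in> E \<Longrightarrow> fire_cluster E (\<lambda>_. Flammable) e = E"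
    and split: "\<And>e. e \<in> E \<Longrightarrow> E - {e} = A e \<union> B e" "\<And>e. e \<in> E \<Longrightarrow> A e \<subseteq> Pow (VA e)"
      "\<And>e. e \<in> E \<Longrightarrow> B e \<subseteq> Pow (VB e)" "\<And>e. e \<in> E \<Longrightarrow> VA e \<inter> VB e = {}"
      "\<And>e. e \<in> E \<Longrightarrow> V = VA e \<union> VB e"
    and p: "0 \<le> p" "p \<le> 1"
  shows "fireproof_char p \<theta> V E = of_real p + of_real (1 - p) *
    (\<Sum>e\<in>E. fireproof_char p \<theta> (VA e) (A e) * fireproof_char p \<theta> (VB e) (B e)) / of_nat (card E)"
proof -
  let ?G = "\<lambda>s. cis (real (card (fireproof_vertices V E s)) * \<theta>)"
  have "fire_step_mean E p E (\<lambda>_. Flammable) ?G e = of_real p +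
      of_real (1 - p) * (fireproof_char p \<theta> (VA e) (A e) * fireproof_char p \<theta> (VB e) (B e))"
    if e: "e \<in> E" for e
  proof -
    let ?b = "burn E (\<lambda>_. Flammable) e"
    have b: "?b f = Burnt" if "f \<in> E" for f using that connected[OF e] by (simp add: burn_def)
    have "fire_mean E p (E - {e}) ?b ?G = ?G ?b"
      by (rule fire_mean_burnt) (simp_all add: E(1) b)
    moreover have "fireproof_vertices V E ?b = {}"
    proof -
      have "\<exists>f\<in>E. v \<in> f \<and> ?b f \<noteq> Fireproof" if v: "v \<in> V" for v
      proof -
        obtain f where "f \<in> E" "v \<in> f" using E(4) v by blast
        then show ?thesis using b[of f] by (intro bexI[of _ f]) simp_all
      qed
      then show ?thesis by (force simp: fireproof_vertices_def)
    qed
    ultimately have "fire_mean E p (E - {e}) ?b ?G = 1" by simp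
    moreover note fire_mean_split[OF E(1,3) e split[OF e] E(5) p, of \<theta>]
    ultimately show ?thesis unfolding fire_step_mean_def by (simp only: edge_state.distinct if_False mult_1_right)
  qed
  note step = this
  have "fireproof_char p \<theta> V E = (\<Sum>e\<in>E. of_real p +
      of_real (1 - p) * (fireproof_char p \<theta> (VA e) (A e) * fireproof_char p \<theta> (VB e) (B e))) / of_nat (card E)"
    unfolding fireproof_char_def[of p \<theta> V E] fire_mean_rec[OF E(1,2) p]
    by (rule arg_cong2[where f = "(/)", OF sum.cong[OF refl step] refl])
  also have "\<dots> = of_real p + of_real (1 - p) *
    (\<Sum>e\<in>E. fireproof_char p \<theta> (VA e) (A e) * fireproof_char p \<theta> (VB e) (B e)) / of_nat (card E)"
  proof -
    have "of_nat (card E) \<noteq> (0::complex)" using E(1,2) by simp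
    then show ?thesis
      unfolding sum.distrib sum_constant sum_distrib_left[symmetric] add_divide_distrib by simp
  qed
  finally show ?thesis .
qed

section \<open>Splitting increasing parent maps\<close>

text \<open>A recursive tree is encoded by sending each vertex to its parent. Arbitrary finite
  \<open>V\<close> with root \<open>Min V\<close> is allowed because the parts of a split tree are
  in general not intervals; extensionality makes the encoding injective.\<close>

definition parent_maps :: "nat set \<Rightarrow> (nat \<Rightarrow> nat) set" where
  "parent_maps V = (\<Pi>\<^sub>E v\<in>V - {Min V}. {u \<in> V. u < v})"

definition parent_edges :: "nat set \<Rightarrow> (nat \<Rightarrow> nat) \<Rightarrow> nat set set" where
  "parent_edges V f = (\<lambda>v. {f v, v}) ` (V - {Min V})"

definition parent_rel :: "nat set \<Rightarrow> (nat \<Rightarrow> nat) \<Rightarrow> (nat \<times> nat) set" where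
  "parent_rel V f = {(u, w). u = f w \<and> w \<in> V - {Min V}}"

definition descendants :: "nat set \<Rightarrow> (nat \<Rightarrow> nat) \<Rightarrow> nat \<Rightarrow> nat set" where
  "descendants V f v = {w. (v, w) \<in> (parent_rel V f)\<^sup>*}"

lemma parent_rel_iff: "(u, w) \<in> parent_rel V f \<longleftrightarrow> u = f w \<and> w \<in> V - {Min V}"
  by (simp add: parent_rel_def)

lemma parent_mapsD:
  assumes "f \<in> parent_maps V" "v \<in> V" "v \<noteq> Min V"
  shows "f v \<in> V" "f v < v"
  using assms by (auto simp: parent_maps_def PiE_iff)

lemma finite_parent_maps [simp]: "finite V \<Longrightarrow> finite (parent_maps V)"
  unfolding parent_maps_def by (intro finite_PiE) auto

text \<open>The largest vertex can be attached to any other one and is nobody's parent, so adding it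
  multiplies the number of maps by the number of vertices already present.\<close>

lemma card_parent_maps:
  assumes "finite V"
  shows "card (parent_maps V) = fact (card V - 1)"
  using assms
proof (induction V rule: finite_linorder_max_induct)
  case empty
  then show ?case by (simp add: parent_maps_def)
next
  case (insert b A)
  show ?case
  proof (cases "A = {}")
    case False
    with insert have "Min (insert b A) = Min A" by (simp add: min_def) (metis Min_in less_le_not_le)
    moreover have "Min A \<noteq> b" using insert False Min_in by blast
    moreover have "b \<notin> A" using insert by blast
    ultimately have "insert b A - {Min (insert b A)} = insert b (A - {Min A})" "b \<notin> A - {Min A}" by auto
    moreover have "{u \<in> insert b A. u < b} = A" using insert by auto
    moreover have "{u \<in> insert b A. u < v} = {u \<in> A. u < v}" if "v \<in> A - {Min A}" for v
      using that insert by auto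
    ultimately have "card (parent_maps (insert b A)) = card A * card (parent_maps A)"
      using insert(1) by (simp add: parent_maps_def card_PiE)
    also have "\<dots> = fact (card A)"
      using False insert by (simp add: insert.IH fact_reduce card_gt_0_iff)
    finally show ?thesis using insert \<open>b \<notin> A\<close> by simp
  qed (simp add: parent_maps_def)
qed

lemma inj_on_parent_edge:
  assumes "f \<in> parent_maps V"
  shows "inj_on (\<lambda>v. {f v, v}) (V - {Min V})"
proof (rule inj_onI)
  fix v w assume "v \<in> V - {Min V}" "w \<in> V - {Min V}" "{f v, v} = {f w, w}"
  then show "v = w"
    using parent_mapsD(2)[OF assms, of v] parent_mapsD(2)[OF assms, of w] by (auto simp: doubleton_eq_iff)
qed

lemma parent_edges_cong:
  "(\<And>v. v \<in> V - {Min V} \<Longrightarrow> f v = g v) \<Longrightarrow> parent_edges V f = parent_edges V g"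
  unfolding parent_edges_def by (intro image_cong) auto

text \<open>Subtrees are described by local conditions on \<open>f\<close>, free of transitive
  closure: inside, only the least vertex has its parent outside; outside, no parent lies inside.
  This lets a pair of map and cut edge be exchanged for a pair of vertex set and map.\<close>

lemma eq_descendants_iff:
  assumes V: "finite V" and f: "f \<in> parent_maps V" and v: "v \<in> V - {Min V}" and S: "S \<subseteq> V"
  shows "S = descendants V f v \<longleftrightarrow> S \<noteq> {} \<and> v = Min S \<and>
    (\<forall>w\<in>S - {v}. f w \<in> S) \<and> (\<forall>w\<in>V - S - {Min V}. f w \<notin> S)" (is "_ \<longleftrightarrow> ?P")
proof
  let ?r = "parent_rel V f"
  have le: "w \<in> V \<and> v \<le> w" if "(v, w) \<in> ?r\<^sup>*" for w
    using that
  proof (induction rule: rtrancl_induct)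
    case (step y z)
    from step.hyps(2) have z: "y = f z" "z \<in> V" "z \<noteq> Min V" by (auto simp: parent_rel_iff)
    then have "f z < z" by (intro parent_mapsD(2)[OF f])
    then show ?case using z(2) step.IH unfolding z(1) by simp
  qed (use v in simp)
  {
    assume S': "S = descendants V f v"
    have "v \<in> S" by (simp add: S' descendants_def)
    moreover have "v = Min S"
    proof (rule Min_eqI[symmetric])
      show "finite S" by (rule finite_subset[OF S V])
      show "v \<le> w" if "w \<in> S" for w
        using le[of w] that unfolding S' descendants_def by simp
    qed fact
    moreover have "f w \<in> S" if "w \<in> S - {v}" for w
    proof -
      from that have "(v, w) \<in> ?r\<^sup>*" "w \<noteq> v" by (auto simp: S' descendants_def)
      then obtain y where "(v, y) \<in> ?r\<^sup>*" "(y, w) \<in> ?r" by (metis rtranclE)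
      then have "(v, f w) \<in> ?r\<^sup>*" by (simp add: parent_rel_iff)
      then show ?thesis by (simp add: S' descendants_def)
    qed
    moreover have "f w \<notin> S" if "w \<in> V - S - {Min V}" for w
    proof
      assume "f w \<in> S"
      then have "(v, f w) \<in> ?r\<^sup>*" by (simp add: S' descendants_def)
      moreover have "(f w, w) \<in> ?r" using that by (simp add: parent_rel_iff)
      ultimately have "(v, w) \<in> ?r\<^sup>*" by (rule rtrancl_into_rtrancl)
      then have "w \<in> S" by (simp add: S' descendants_def)
      then show False using that by simp
    qed
    ultimately show ?P by blast
  }
  assume P: ?P
  then have vS: "v \<in> S" "\<And>w. w \<in> S \<Longrightarrow> v \<le> w" using V S finite_subset[OF S V] by auto
  have "Min V \<notin> S"
    using vS(2) Min_le[OF V, of v] v by fastforce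
  have "w \<in> S \<Longrightarrow> (v, w) \<in> ?r\<^sup>*" for w
  proof (induction w rule: less_induct)
    case (less w)
    show ?case
    proof (cases "w = v")
      case False
      have "w \<in> V" "w \<noteq> Min V" using less.prems S \<open>Min V \<notin> S\<close> by auto
      moreover have "f w \<in> S" using P False less.prems by blast
      ultimately have "(v, f w) \<in> ?r\<^sup>*" "(f w, w) \<in> ?r"
        using less.IH[of "f w"] parent_mapsD[OF f] by (auto simp: parent_rel_iff)
      then show ?thesis by (rule rtrancl_into_rtrancl)
    qed simp
  qed
  moreover have "w \<in> S" if "(v, w) \<in> ?r\<^sup>*" for w
    using that
  proof (induction rule: rtrancl_induct)
    case (step y z)
    from step.hyps(2) have "y = f z" "z \<in> V - {Min V}" by (auto simp: parent_rel_iff)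
    then show ?case using P step.IH by blast
  qed (use vS in simp)
  ultimately show "S = descendants V f v" by (auto simp: descendants_def)
qed

lemma descendants_facts:
  assumes V: "finite V" and f: "f \<in> parent_maps V" and v: "v \<in> V - {Min V}"
  defines "S \<equiv> descendants V f v"
  shows "S \<subseteq> V" "S \<noteq> {}" "Min S = v" "Min V \<notin> S"
    "\<And>w. w \<in> S - {v} \<Longrightarrow> f w \<in> S" "\<And>w. w \<in> V - S - {Min V} \<Longrightarrow> f w \<notin> S"
proof -
  let ?r = "parent_rel V f"
  have "w \<in> V" if "(v, w) \<in> ?r\<^sup>*" for w
    using that by cases (use v in \<open>auto simp: parent_rel_iff\<close>)
  then show S: "S \<subseteq> V" by (auto simp: S_def descendants_def)
  from eq_descendants_iff[OF V f v S] have *: "S \<noteq> {} \<and> v = Min S \<and>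
    (\<forall>w\<in>S - {v}. f w \<in> S) \<and> (\<forall>w\<in>V - S - {Min V}. f w \<notin> S)" by (simp add: S_def)
  then show "S \<noteq> {}" "Min S = v" "\<And>w. w \<in> S - {v} \<Longrightarrow> f w \<in> S" "\<And>w. w \<in> V - S - {Min V} \<Longrightarrow> f w \<notin> S"
    by auto
  show "Min V \<notin> S"
  proof
    assume "Min V \<in> S"
    then have "v \<le> Min V" using * finite_subset[OF S V] by simp
    then show False using v Min_le[OF V, of v] by auto
  qed
qed

lemma Min_Diff_eq:
  fixes V :: "nat set"
  assumes "finite V" "V \<noteq> {}" "Min V \<notin> S"
  shows "Min (V - S) = Min V"
  using assms by (intro Min_eqI) auto

lemma fire_cluster_parent_edges:
  assumes V: "finite V" and f: "f \<in> parent_maps V" and e: "e \<in> parent_edges V f"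
  shows "fire_cluster (parent_edges V f) (\<lambda>_. Flammable) e = parent_edges V f"
proof -
  let ?E = "parent_edges V f"
  define r where "r = {(f, g). f \<in> ?E \<and> g \<in> ?E \<and> f \<inter> g \<noteq> {}}"
  have cl: "fire_cluster ?E (\<lambda>_. Flammable) e = r\<^sup>* `` {e}"
    by (simp add: fire_cluster_def r_def)
  \<comment> \<open>The second smallest vertex can only have the root as its parent; every edge is
    linked to that edge through the chain of ancestors.\<close>
  define v0 where "v0 = Min (V - {Min V})"
  have "V - {Min V} \<noteq> {}" using e by (auto simp: parent_edges_def)
  then have v0: "v0 \<in> V" "v0 \<noteq> Min V" "\<And>w. w \<in> V - {Min V} \<Longrightarrow> v0 \<le> w"
    using V Min_in[of "V - {Min V}"] by (auto simp: v0_def)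
  have fv0: "f v0 = Min V"
    using parent_mapsD[OF f v0(1,2)] v0(3)[of "f v0"] by force
  have "v \<in> V - {Min V} \<Longrightarrow> ({f v0, v0}, {f v, v}) \<in> r\<^sup>*" for v
  proof (induction v rule: less_induct)
    case (less v)
    then have fv: "f v \<in> V" "f v < v" using parent_mapsD[OF f, of v] by auto
    have vE: "{f v, v} \<in> ?E" using less.prems by (auto simp: parent_edges_def)
    show ?case
    proof (cases "f v = Min V")
      case True
      have "{f v0, v0} \<in> ?E" using v0 by (auto simp: parent_edges_def)
      with True vE fv0 have "({f v0, v0}, {f v, v}) \<in> r" by (auto simp: r_def)
      then show ?thesis by blast
    next
      case False
      then have "({f v0, v0}, {f (f v), f v}) \<in> r\<^sup>*" using less.IH fv by auto
      moreover have "{f (f v), f v} \<in> ?E" using False fv by (auto simp: parent_edges_def)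
      then have "({f (f v), f v}, {f v, v}) \<in> r" using vE by (auto simp: r_def)
      ultimately show ?thesis by (rule rtrancl_into_rtrancl)
    qed
  qed
  then have from0: "({f v0, v0}, g) \<in> r\<^sup>*" if "g \<in> ?E" for g
    using that by (auto simp: parent_edges_def)
  have "sym r" by (auto simp: r_def sym_def)
  then have "sym (r\<^sup>*)" by (rule sym_rtrancl)
  then have "(e, g) \<in> r\<^sup>*" if "g \<in> ?E" for g
    using from0[OF e] from0[OF that] by (meson symD rtrancl_trans)
  moreover have "g \<in> ?E" if "(e, g) \<in> r\<^sup>*" for g
    using that by cases (use e in \<open>auto simp: r_def\<close>)
  ultimately show ?thesis unfolding cl by auto
qed

lemma fireproof_char_parent_edges:
  assumes V: "finite V" "2 \<le> card V" and f: "f \<in> parent_maps V" and p: "0 \<le> p" "p \<le> 1"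
  shows "fireproof_char p \<theta> V (parent_edges V f) = of_real p + of_real (1 - p) *
    (\<Sum>v\<in>V - {Min V}. fireproof_char p \<theta> (descendants V f v) (parent_edges (descendants V f v) f) *
       fireproof_char p \<theta> (V - descendants V f v) (parent_edges (V - descendants V f v) f)) / of_nat (card V - 1)"
proof -
  let ?D = "descendants V f"
  let ?E = "parent_edges V f"
  let ?X = "\<lambda>v. fireproof_char p \<theta> (?D v) (parent_edges (?D v) f) * fireproof_char p \<theta> (V - ?D v) (parent_edges (V - ?D v) f)"
  have "V \<noteq> {}" using V by auto
  then have MinV: "Min V \<in> V" using V by simp
  have edge: "\<exists>v\<in>V - {Min V}. e = {f v, v} \<and> Max e = v" if "e \<in> ?E" for e
  proof -
    from that obtain v where v: "v \<in> V - {Min V}" "e = {f v, v}" by (auto simp: parent_edges_def)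
    with parent_mapsD[OF f, of v] have "Max e = v" by (auto simp: max_def)
    with v show ?thesis by blast
  qed
  have cardE: "card ?E = card V - 1"
    unfolding parent_edges_def using card_image[OF inj_on_parent_edge[OF f]] V MinV by simp
  \<comment> \<open>An edge is identified with its child endpoint, which is its maximum, so that the
    two parts become functions of the edge.\<close>
  have *: "fireproof_char p \<theta> V ?E = of_real p + of_real (1 - p) * (\<Sum>e\<in>?E. ?X (Max e)) / of_nat (card ?E)"
  proof (rule fireproof_char_rec)
    show "finite ?E" using V by (simp add: parent_edges_def)
    show "?E \<noteq> {}" using cardE V by auto
    show "{} \<notin> ?E" by (auto simp: parent_edges_def)
    define v0 where "v0 = Min (V - {Min V})"
    have "card (V - {Min V}) \<noteq> 0" using V MinV by simp
    then have "V - {Min V} \<noteq> {}" by (metis card.empty)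
    then have v0: "v0 \<in> V" "v0 \<noteq> Min V" "\<And>w. w \<in> V - {Min V} \<Longrightarrow> v0 \<le> w"
      using V Min_in[of "V - {Min V}"] by (auto simp: v0_def)
    have "f v0 = Min V"
      using parent_mapsD[OF f v0(1,2)] v0(3)[of "f v0"] by force
    then have "Min V \<in> {f v0, v0}" by simp
    moreover have "{f v0, v0} \<in> ?E" unfolding parent_edges_def using v0(1,2) by blast
    ultimately have "Min V \<in> \<Union>?E" by (rule UnionI[rotated])
    moreover have "w \<in> \<Union>?E" if "w \<in> V" "w \<noteq> Min V" for w
    proof
      show "{f w, w} \<in> ?E" using that unfolding parent_edges_def by blast
    qed simp
    ultimately show "V \<subseteq> \<Union>?E" by blast
    show "fire_cluster ?E (\<lambda>_. Flammable) e = ?E" if "e \<in> ?E" for e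
      by (rule fire_cluster_parent_edges[OF V(1) f that])
    fix e assume "e \<in> ?E"
    with edge obtain v where v: "v \<in> V - {Min V}" "e = {f v, v}" "Max e = v" by blast
    note D = descendants_facts[OF V(1) f v(1)]
    have MinD: "Min (V - ?D v) = Min V"
      using V(1) \<open>V \<noteq> {}\<close> D(4) by (rule Min_Diff_eq)
    have vD: "v \<in> ?D v" using D(1-3) V finite_subset by (metis Min_in)
    have "?E - {e} = (\<lambda>w. {f w, w}) ` (V - {Min V} - {v})"
      unfolding parent_edges_def v(2) using inj_on_image_set_diff[OF inj_on_parent_edge[OF f], of "V - {Min V}" "{v}"] v(1) by auto
    also have "V - {Min V} - {v} = (?D v - {v}) \<union> (V - ?D v - {Min V})"
      using D(1,4) vD by auto
    finally show "?E - {e} = parent_edges (?D (Max e)) f \<union> parent_edges (V - ?D (Max e)) f"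
      unfolding v(3) parent_edges_def MinD D(3) image_Un .
    show "parent_edges (?D (Max e)) f \<subseteq> Pow (?D (Max e))"
      unfolding v(3) parent_edges_def D(3) using D(5) by auto
    show "parent_edges (V - ?D (Max e)) f \<subseteq> Pow (V - ?D (Max e))"
      unfolding v(3) parent_edges_def MinD using D(6) parent_mapsD(1)[OF f] by auto
    show "?D (Max e) \<inter> (V - ?D (Max e)) = {}" by auto
    show "V = ?D (Max e) \<union> (V - ?D (Max e))" using D(1) v(3) by auto
  qed (use V p in auto)
  also have "(\<Sum>e\<in>?E. ?X (Max e)) = (\<Sum>v\<in>V - {Min V}. ?X (Max {f v, v}))"
    unfolding parent_edges_def by (rule sum.reindex_cong[OF inj_on_parent_edge[OF f]]) auto
  also have "\<dots> = (\<Sum>v\<in>V - {Min V}. ?X v)"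
  proof (intro sum.cong refl)
    fix v assume "v \<in> V - {Min V}"
    with parent_mapsD[OF f, of v] have "Max {f v, v} = v" by (auto simp: max_def)
    then show "?X (Max {f v, v}) = ?X v" by simp
  qed
  finally show ?thesis by (simp only: cardE)
qed

section \<open>Enumeration by the vertex set cut off\<close>

definition split_maps :: "nat set \<Rightarrow> nat set \<Rightarrow> (nat \<Rightarrow> nat) set" where
  "split_maps V S = {f \<in> parent_maps V. (\<forall>w\<in>S - {Min S}. f w \<in> S) \<and> (\<forall>w\<in>V - S - {Min V}. f w \<notin> S)}"

text \<open>The bijection sends \<open>(f, v)\<close> to \<open>(descendants V f v, f)\<close>, and
  \<open>v\<close> is recovered as the minimum of the set; by \<open>eq_descendants_iff\<close> the
  maps that go with \<open>S\<close> are those in \<open>split_maps V S\<close>.\<close>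

lemma sum_parent_maps_descendants:
  fixes h :: "nat set \<Rightarrow> (nat \<Rightarrow> nat) \<Rightarrow> complex"
  assumes V: "finite V"
  shows "(\<Sum>f\<in>parent_maps V. \<Sum>v\<in>V - {Min V}. h (descendants V f v) f)
    = (\<Sum>S\<in>{S. S \<noteq> {} \<and> S \<subseteq> V - {Min V}}. \<Sum>f\<in>split_maps V S. h S f)"
proof -
  have S: "S \<subseteq> V \<and> S \<noteq> {} \<and> Min S \<in> V - {Min V}" if "S \<noteq> {}" "S \<subseteq> V - {Min V}" for S
  proof -
    have "Min S \<in> S" using that V finite_subset by (intro Min_in) auto
    with that show ?thesis by auto
  qed
  have fin: "finite (split_maps V S)" "finite {S. S \<noteq> {} \<and> S \<subseteq> V - {Min V}}" for S
    using V by (auto simp: split_maps_def intro: finite_subset[of _ "Pow V"])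
  have "(\<Sum>f\<in>parent_maps V. \<Sum>v\<in>V - {Min V}. h (descendants V f v) f)
      = (\<Sum>(f, v)\<in>parent_maps V \<times> (V - {Min V}). h (descendants V f v) f)"
    using V by (simp add: sum.cartesian_product)
  also have "\<dots> = (\<Sum>(S, f)\<in>(SIGMA S:{S. S \<noteq> {} \<and> S \<subseteq> V - {Min V}}. split_maps V S). h S f)"
  proof (rule sum.reindex_bij_witness[where i = "\<lambda>(S, f). (f, Min S)" and j = "\<lambda>(f, v). (descendants V f v, f)"])
    fix a assume "a \<in> parent_maps V \<times> (V - {Min V})"
    then obtain f v where a: "a = (f, v)" "f \<in> parent_maps V" "v \<in> V - {Min V}" by auto
    note D = descendants_facts[OF V a(2,3)]
    show "(\<lambda>(S, f). (f, Min S)) ((\<lambda>(f, v). (descendants V f v, f)) a) = a"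
      using a D(3) by simp
    have "descendants V f v \<subseteq> V - {Min V}" using D(1,4) by auto
    moreover have "f \<in> split_maps V (descendants V f v)"
      unfolding split_maps_def using D(3,5,6) a(2) by auto
    ultimately show "(\<lambda>(f, v). (descendants V f v, f)) a \<in> (SIGMA S:{S. S \<noteq> {} \<and> S \<subseteq> V - {Min V}}. split_maps V S)"
      using a D(2) by simp
    show "(\<lambda>(S, f). h S f) ((\<lambda>(f, v). (descendants V f v, f)) a) = (\<lambda>(f, v). h (descendants V f v) f) a"
      using a by simp
  next
    fix b assume "b \<in> (SIGMA S:{S. S \<noteq> {} \<and> S \<subseteq> V - {Min V}}. split_maps V S)"
    then obtain S f where b: "b = (S, f)" "S \<noteq> {}" "S \<subseteq> V - {Min V}" "f \<in> split_maps V S" by auto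
    have f: "f \<in> parent_maps V" using b by (simp add: split_maps_def)
    note SS = S[OF b(2,3)]
    have "S = descendants V f (Min S)"
      using SS b(4) by (subst eq_descendants_iff[OF V f]) (auto simp: split_maps_def)
    then show "(\<lambda>(f, v). (descendants V f v, f)) ((\<lambda>(S, f). (f, Min S)) b) = b"
      using b by simp
    show "(\<lambda>(S, f). (f, Min S)) b \<in> parent_maps V \<times> (V - {Min V})"
      using b f SS by simp
  qed
  also have "\<dots> = (\<Sum>S\<in>{S. S \<noteq> {} \<and> S \<subseteq> V - {Min V}}. \<Sum>f\<in>split_maps V S. h S f)"
    using fin by (intro sum.Sigma[symmetric]) auto
  finally show ?thesis .
qed

text \<open>A map in \<open>split_maps V S\<close> is assembled freely from a parent map of
  \<open>S\<close>, one of \<open>V - S\<close>, and a parent for \<open>Min S\<close>, which may be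
  any smaller vertex of \<open>V\<close> since all of these lie outside \<open>S\<close>. The
  factorisation expresses that the two parts are independent given their vertex sets.\<close>

lemma sum_split_maps:
  fixes g k :: "(nat \<Rightarrow> nat) \<Rightarrow> complex"
  assumes V: "finite V" and S: "S \<noteq> {}" "S \<subseteq> V - {Min V}"
    and g: "\<And>f f'. (\<And>w. w \<in> S - {Min S} \<Longrightarrow> f w = f' w) \<Longrightarrow> g f = g f'"
    and k: "\<And>f f'. (\<And>w. w \<in> V - S - {Min V} \<Longrightarrow> f w = f' w) \<Longrightarrow> k f = k f'"
  shows "(\<Sum>f\<in>split_maps V S. g f * k f)
    = of_nat (card {u \<in> V. u < Min S}) * ((\<Sum>f\<in>parent_maps S. g f) * (\<Sum>f\<in>parent_maps (V - S). k f))"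
proof -
  have finS: "finite S" using S V finite_subset by (metis finite_Diff)
  have MinS: "Min S \<in> S" using S finS by simp
  have "V \<noteq> {}" using S by auto
  then have MinVS: "Min (V - S) = Min V" using V S by (intro Min_Diff_eq) auto
  let ?U = "{u \<in> V. u < Min S}"
  have U: "u \<notin> S" if "u < Min S" for u using Min_le[OF finS, of u] that by auto
  let ?j = "\<lambda>f. (f (Min S), restrict f (S - {Min S}), restrict f (V - S - {Min V}))"
  let ?i = "\<lambda>(u, f1, f2) w. if w \<in> S - {Min S} then f1 w else if w = Min S then u
      else if w \<in> V - S - {Min V} then f2 w else undefined"
  have "(\<Sum>f\<in>split_maps V S. g f * k f) = (\<Sum>(u, f1, f2)\<in>?U \<times> parent_maps S \<times> parent_maps (V - S). g f1 * k f2)"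
  proof (rule sum.reindex_bij_witness[where i = ?i and j = ?j])
    fix f assume f: "f \<in> split_maps V S"
    then have fV: "f \<in> parent_maps V" by (simp add: split_maps_def)
    have outside: "f w = undefined" if "w \<notin> V - {Min V}" for w
      using fV that unfolding parent_maps_def by (rule PiE_arb)
    show "?i (?j f) = f"
      using S MinS outside by (intro ext) auto
    have less: "f w \<in> V \<and> f w < w" if "w \<in> V" "w \<noteq> Min V" for w using parent_mapsD[OF fV that] by simp
    have "f (Min S) \<in> ?U" using less[of "Min S"] MinS S by auto
    moreover have "restrict f (S - {Min S}) \<in> parent_maps S"
      unfolding parent_maps_def using f S less by (intro restrict_PiE_iff[THEN iffD2] ballI) (auto simp: split_maps_def)
    moreover have "restrict f (V - S - {Min V}) \<in> parent_maps (V - S)"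
      unfolding parent_maps_def MinVS using f less by (intro restrict_PiE_iff[THEN iffD2] ballI) (auto simp: split_maps_def)
    ultimately show "?j f \<in> ?U \<times> parent_maps S \<times> parent_maps (V - S)" by simp
    have "g (restrict f (S - {Min S})) = g f" by (rule g) simp
    moreover have "k (restrict f (V - S - {Min V})) = k f" by (rule k) simp
    ultimately show "(\<lambda>(u, f1, f2). g f1 * k f2) (?j f) = g f * k f" by simp
  next
    fix b assume "b \<in> ?U \<times> parent_maps S \<times> parent_maps (V - S)"
    then obtain u f1 f2 where b: "b = (u, f1, f2)" "u \<in> V" "u < Min S" "f1 \<in> parent_maps S" "f2 \<in> parent_maps (V - S)"
      by auto
    have f1: "f1 w \<in> S" "f1 w < w" if "w \<in> S" "w \<noteq> Min S" for w using parent_mapsD[OF b(4) that] by auto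
    have f2: "f2 w \<in> V - S" "f2 w < w" if "w \<in> V - S" "w \<noteq> Min V" for w
      using parent_mapsD[OF b(5), of w] that by (auto simp: MinVS)
    have arb1: "f1 w = undefined" if "w \<notin> S - {Min S}" for w
      using b(4) that unfolding parent_maps_def by (rule PiE_arb)
    have arb2: "f2 w = undefined" if "w \<notin> V - S - {Min V}" for w
      using b(5) that unfolding parent_maps_def MinVS by (rule PiE_arb)
    have "?i b \<in> parent_maps V"
      unfolding parent_maps_def
    proof (rule PiE_I)
      fix w assume "w \<in> V - {Min V}"
      then show "?i b w \<in> {u \<in> V. u < w}"
        using b(1-3) S f1[of w] f2[of w] by auto
    next
      fix w assume "w \<notin> V - {Min V}"
      then show "?i b w = undefined" using b(1) S MinS by auto
    qed
    moreover have "?i b w \<in> S" if "w \<in> S - {Min S}" for w using that f1 b(1) by simp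
    moreover have "?i b w \<notin> S" if "w \<in> V - S - {Min V}" for w using that f2[of w] b(1) MinS by auto
    ultimately show "?i b \<in> split_maps V S" unfolding split_maps_def by blast
    have "restrict (?i b) (S - {Min S}) = f1" using b(1) arb1 by (intro ext) auto
    moreover have "restrict (?i b) (V - S - {Min V}) = f2" using b(1) arb2 MinS by (intro ext) auto
    moreover have "?i b (Min S) = u" using b(1) by simp
    ultimately show "?j (?i b) = b" using b(1) by simp
  qed
  also have "\<dots> = (\<Sum>u\<in>?U. \<Sum>f1\<in>parent_maps S. \<Sum>f2\<in>parent_maps (V - S). g f1 * k f2)"
    by (simp only: sum.cartesian_product)
  also have "\<dots> = of_nat (card ?U) * ((\<Sum>f\<in>parent_maps S. g f) * (\<Sum>f\<in>parent_maps (V - S). k f))"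
    by (simp add: sum_product)
  finally show ?thesis .
qed

text \<open>Adjoining \<open>u\<close> to \<open>S\<close> gives a set of \<open>k + 1\<close>
  vertices with minimum \<open>u\<close>, and every such set arises exactly once. As
  \<open>k \<ge> 1\<close>, what remains after removing the minimum is nonempty and has a minimum of
  its own.\<close>

lemma sum_card_less_Min:
  assumes V: "finite V" and k: "1 \<le> k"
  shows "(\<Sum>S\<in>{S. S \<subseteq> V - {Min V} \<and> card S = k}. card {u \<in> V. u < Min S}) = card V choose (k + 1)"
proof -
  let ?A = "{S. S \<subseteq> V - {Min V} \<and> card S = k}"
  have fin: "finite S" if "S \<subseteq> V" for S using that V by (rule finite_subset)
  have "(\<Sum>S\<in>?A. card {u \<in> V. u < Min S}) = card (SIGMA S:?A. {u \<in> V. u < Min S})"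
    using V by (intro card_SigmaI[symmetric]) (auto intro: finite_subset[of _ "Pow V"])
  also have "\<dots> = card {T. T \<subseteq> V \<and> card T = k + 1}"
  proof (rule bij_betw_same_card[of "\<lambda>(S, u). insert u S"], rule bij_betw_byWitness[where f' = "\<lambda>T. (T - {Min T}, Min T)"])
    show "\<forall>a\<in>SIGMA S:?A. {u \<in> V. u < Min S}. (\<lambda>T. (T - {Min T}, Min T)) ((\<lambda>(S, u). insert u S) a) = a"
    proof
      fix a assume "a \<in> (SIGMA S:?A. {u \<in> V. u < Min S})"
      then obtain S u where a: "a = (S, u)" "S \<subseteq> V" "u < Min S" by auto
      have less: "u < w" if "w \<in> S" for w
        by (rule less_le_trans[OF a(3) Min_le[OF fin[OF a(2)] that]])
      have "Min (insert u S) = u"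
        using fin[OF a(2)] less by (intro Min_eqI) (auto simp: less_imp_le)
      moreover have "u \<notin> S" using less by blast
      ultimately show "(\<lambda>T. (T - {Min T}, Min T)) ((\<lambda>(S, u). insert u S) a) = a" by (simp add: a(1))
    qed
    have Min: "Min T \<in> T" if "T \<subseteq> V" "card T = k + 1" for T
      using that fin by (intro Min_in) auto
    then show "\<forall>T\<in>{T. T \<subseteq> V \<and> card T = k + 1}. (\<lambda>(S, u). insert u S) ((\<lambda>T. (T - {Min T}, Min T)) T) = T"
      by (simp add: insert_absorb)
    show "(\<lambda>(S, u). insert u S) ` (SIGMA S:?A. {u \<in> V. u < Min S}) \<subseteq> {T. T \<subseteq> V \<and> card T = k + 1}"
    proof
      fix T assume "T \<in> (\<lambda>(S, u). insert u S) ` (SIGMA S:?A. {u \<in> V. u < Min S})"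
      then obtain S u where T: "T = insert u S" "S \<subseteq> V" "card S = k" "u \<in> V" "u < Min S" by auto
      have "u \<notin> S" using T(5) Min_le[OF fin[OF T(2)], of u] by auto
      then show "T \<in> {T. T \<subseteq> V \<and> card T = k + 1}" using T fin[OF T(2)] by simp
    qed
    show "(\<lambda>T. (T - {Min T}, Min T)) ` {T. T \<subseteq> V \<and> card T = k + 1} \<subseteq> (SIGMA S:?A. {u \<in> V. u < Min S})"
    proof
      fix a assume "a \<in> (\<lambda>T. (T - {Min T}, Min T)) ` {T. T \<subseteq> V \<and> card T = k + 1}"
      then obtain T where T: "a = (T - {Min T}, Min T)" "T \<subseteq> V" "card T = k + 1" by auto
      have M: "Min T \<in> T" by (rule Min[OF T(2,3)])
      have less: "Min T < w" if "w \<in> T - {Min T}" for w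
        using that Min_le[OF fin[OF T(2)], of w] by auto
      have card: "card (T - {Min T}) = k" using M T(3) fin[OF T(2)] by simp
      then have "T - {Min T} \<noteq> {}" using k by (metis card.empty not_one_le_zero)
      then have "Min (T - {Min T}) \<in> T - {Min T}" using fin[OF T(2)] by (intro Min_in) auto
      then have lt: "Min T < Min (T - {Min T})" by (rule less)
      have "Min V \<notin> T - {Min T}"
      proof
        assume "Min V \<in> T - {Min T}"
        then have "Min T < Min V" by (rule less)
        moreover have "Min V \<le> Min T" using V M T(2) by auto
        ultimately show False by simp
      qed
      then have "T - {Min T} \<subseteq> V - {Min V}" using T(2) by blast
      then show "a \<in> (SIGMA S:?A. {u \<in> V. u < Min S})"
        using card lt M T by auto
    qed
  qed
  also have "\<dots> = card V choose (k + 1)" using V by (rule n_subsets)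
  finally show ?thesis .
qed

section \<open>Sums over all recursive trees on a vertex set\<close>

definition fireproof_sum :: "real \<Rightarrow> real \<Rightarrow> nat set \<Rightarrow> complex" where
  "fireproof_sum p \<theta> V = (\<Sum>f\<in>parent_maps V. fireproof_char p \<theta> V (parent_edges V f))"

lemma fireproof_sum_rec:
  assumes V: "finite V" "2 \<le> card V" and p: "0 \<le> p" "p \<le> 1"
  shows "fireproof_sum p \<theta> V = of_real p * fact (card V - 1) + of_real (1 - p) *
    (\<Sum>S\<in>{S. S \<noteq> {} \<and> S \<subseteq> V - {Min V}}.
      of_nat (card {u \<in> V. u < Min S}) * (fireproof_sum p \<theta> S * fireproof_sum p \<theta> (V - S))) / of_nat (card V - 1)"
proof -
  let ?g = "\<lambda>S f. fireproof_char p \<theta> S (parent_edges S f)"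
  have "fireproof_sum p \<theta> V = (\<Sum>f\<in>parent_maps V. of_real p + of_real (1 - p) *
    (\<Sum>v\<in>V - {Min V}. ?g (descendants V f v) f * ?g (V - descendants V f v) f) / of_nat (card V - 1))"
    unfolding fireproof_sum_def by (intro sum.cong refl fireproof_char_parent_edges V p)
  also have "\<dots> = of_real p * fact (card V - 1) + of_real (1 - p) *
    (\<Sum>f\<in>parent_maps V. \<Sum>v\<in>V - {Min V}. ?g (descendants V f v) f * ?g (V - descendants V f v) f) / of_nat (card V - 1)"
    by (simp only: sum.distrib sum_constant card_parent_maps[OF V(1)] sum_distrib_left sum_divide_distrib of_nat_fact mult.commute)
  also have "(\<Sum>f\<in>parent_maps V. \<Sum>v\<in>V - {Min V}. ?g (descendants V f v) f * ?g (V - descendants V f v) f)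
      = (\<Sum>S\<in>{S. S \<noteq> {} \<and> S \<subseteq> V - {Min V}}. \<Sum>f\<in>split_maps V S. ?g S f * ?g (V - S) f)"
    by (rule sum_parent_maps_descendants[OF V(1), where h = "\<lambda>S f. ?g S f * ?g (V - S) f"])
  also have "\<dots> = (\<Sum>S\<in>{S. S \<noteq> {} \<and> S \<subseteq> V - {Min V}}.
      of_nat (card {u \<in> V. u < Min S}) * (fireproof_sum p \<theta> S * fireproof_sum p \<theta> (V - S)))"
    unfolding fireproof_sum_def
  proof (intro sum.cong refl)
    fix S assume S: "S \<in> {S. S \<noteq> {} \<and> S \<subseteq> V - {Min V}}"
    then have "V \<noteq> {}" by auto
    then have M: "Min (V - S) = Min V" using V S by (intro Min_Diff_eq) auto
    show "(\<Sum>f\<in>split_maps V S. ?g S f * ?g (V - S) f) = of_nat (card {u \<in> V. u < Min S}) *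
       ((\<Sum>f\<in>parent_maps S. ?g S f) * (\<Sum>f\<in>parent_maps (V - S). ?g (V - S) f))"
    proof (rule sum_split_maps)
      show "?g S f = ?g S f'" if "\<And>w. w \<in> S - {Min S} \<Longrightarrow> f w = f' w" for f f'
        using parent_edges_cong[of S f f'] that by simp
      show "?g (V - S) f = ?g (V - S) f'" if "\<And>w. w \<in> V - S - {Min V} \<Longrightarrow> f w = f' w" for f f'
        using parent_edges_cong[of "V - S" f f'] that by (simp add: M)
    qed (use S V in auto)
  qed
  finally show ?thesis .
qed

lemma sum_nonempty_subsets_by_card:
  fixes h :: "nat set \<Rightarrow> complex"
  assumes V: "finite V" "V \<noteq> {}"
  shows "(\<Sum>S\<in>{S. S \<noteq> {} \<and> S \<subseteq> V - {Min V}}. h S)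
    = (\<Sum>k=1..<card V. \<Sum>S\<in>{S. S \<subseteq> V - {Min V} \<and> card S = k}. h S)"
proof -
  let ?B = "{S. S \<noteq> {} \<and> S \<subseteq> V - {Min V}}"
  have c: "card (V - {Min V}) = card V - 1" using V by simp
  have "card S \<in> {1..<card V}" if "S \<in> ?B" for S
  proof -
    have "finite S" using that V finite_subset[of S "V - {Min V}"] by auto
    then have "0 < card S" using that by (simp add: card_gt_0_iff)
    moreover have "card S \<le> card V - 1" using that V c card_mono[of "V - {Min V}" S] by auto
    ultimately show ?thesis by auto
  qed
  then have im: "card ` ?B \<subseteq> {1..<card V}" by blast
  have "finite ?B" by (rule finite_subset[of _ "Pow V"]) (use V(1) in auto)
  from sum.group[OF this _ im, of h]
  have "(\<Sum>S\<in>?B. h S) = (\<Sum>k\<in>{1..<card V}. \<Sum>S\<in>{S \<in> ?B. card S = k}. h S)"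
    by (simp only: finite_atLeastLessThan simp_thms)
  also have "\<dots> = (\<Sum>k=1..<card V. \<Sum>S\<in>{S. S \<subseteq> V - {Min V} \<and> card S = k}. h S)"
    by (intro sum.cong) auto
  finally show ?thesis .
qed

text \<open>Relabelling invariance comes for free: by induction the recursion for \<open>fireproof_sum\<close> only involves
  cardinalities.\<close>

lemma fireproof_sum_rec_card:
  fixes p \<theta> :: real
  defines "\<Phi> \<equiv> \<lambda>n. fireproof_sum p \<theta> {1..n} / fact (n - 1)"
  assumes p: "0 \<le> p" "p \<le> 1" and V: "finite V" "2 \<le> card V"
    and IH: "\<And>W. finite W \<Longrightarrow> W \<noteq> {} \<Longrightarrow> card W < card V \<Longrightarrow> fireproof_sum p \<theta> W = fact (card W - 1) * \<Phi> (card W)"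
  shows "fireproof_sum p \<theta> V = fact (card V - 1) * (of_real p + of_real (1 - p) *
    (\<Sum>k=1..<card V. of_real (split_weight (card V) k) * (\<Phi> k * \<Phi> (card V - k))))"
proof -
  let ?n = "card V"
  have "V \<noteq> {}" using V by auto
  let ?h = "\<lambda>S. of_nat (card {u \<in> V. u < Min S}) * (fireproof_sum p \<theta> S * fireproof_sum p \<theta> (V - S))"
  have "(\<Sum>S\<in>{S. S \<subseteq> V - {Min V} \<and> card S = k}. ?h S) / of_nat (?n - 1)
      = fact (?n - 1) * (of_real (split_weight ?n k) * (\<Phi> k * \<Phi> (?n - k)))" if k: "k \<in> {1..<?n}" for k
  proof -
    have "(\<Sum>S\<in>{S. S \<subseteq> V - {Min V} \<and> card S = k}. ?h S)
        = (\<Sum>S\<in>{S. S \<subseteq> V - {Min V} \<and> card S = k}. of_nat (card {u \<in> V. u < Min S}) *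
            (fact (k - 1) * \<Phi> k * (fact (?n - k - 1) * \<Phi> (?n - k))))"
    proof (intro sum.cong refl)
      fix S assume S: "S \<in> {S. S \<subseteq> V - {Min V} \<and> card S = k}"
      then have "S \<subseteq> V" by auto
      then have fS: "finite S" using V by (intro finite_subset[of S V])
      then have cS: "card (V - S) = ?n - k" using \<open>S \<subseteq> V\<close> S by (simp add: card_Diff_subset)
      then have "card (V - S) \<noteq> 0" using k by simp
      then have "V - S \<noteq> {}" by (metis card.empty)
      moreover have "S \<noteq> {}" using S k by auto
      ultimately show "?h S = of_nat (card {u \<in> V. u < Min S}) * (fact (k - 1) * \<Phi> k * (fact (?n - k - 1) * \<Phi> (?n - k)))"
        using IH[of S] IH[of "V - S"] fS cS S k V by simp
    qed
    also have "\<dots> = of_nat (?n choose (k + 1)) * (fact (k - 1) * \<Phi> k * (fact (?n - k - 1) * \<Phi> (?n - k)))"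
      using sum_card_less_Min[OF V(1), of k] k
      by (simp only: sum_distrib_right[symmetric] of_nat_sum[symmetric] atLeastLessThan_iff)
    finally have 1: "(\<Sum>S\<in>{S. S \<subseteq> V - {Min V} \<and> card S = k}. ?h S)
      = of_nat (?n choose (k + 1)) * (fact (k - 1) * \<Phi> k * (fact (?n - k - 1) * \<Phi> (?n - k)))" .
    \<comment> \<open>Origin of the splitting weights: the binomial coefficient counts the sets with
      an attachment vertex, the factorials of \<open>k - 1\<close> and \<open>n - k - 1\<close>
      count the trees on the two parts, and \<open>n - 1\<close> is the number of edges to choose
      from.\<close>
    have "real (?n choose (k + 1)) * fact (k - 1) * fact (?n - k - 1) / real (?n - 1) = fact (?n - 1) * split_weight ?n k"
    proof -
      have k1: "1 \<le> k" "1 \<le> ?n" using k by auto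
      have f1: "fact (k + 1) = (real k + 1) * (real k * fact (k - 1))"
        using k1 by (simp add: fact_reduce[of k])
      have f2: "fact ?n = real ?n * fact (?n - 1)" using k1 by (simp add: fact_reduce[of ?n])
      have "real (?n choose (k + 1)) = fact ?n / (fact (k + 1) * fact (?n - (k + 1)))"
        using k by (intro binomial_fact) auto
      then have "real (?n choose (k + 1)) * fact (k - 1) * fact (?n - k - 1)
          = fact ?n * fact (k - 1) / fact (k + 1)"
        by simp
      also have "\<dots> = fact (?n - 1) * (real ?n / (real k * (real k + 1)))"
        unfolding f1 f2 by (simp add: mult.commute)
      finally show ?thesis by (simp add: split_weight_def)
    qed
    then have "complex_of_real (real (?n choose (k + 1)) * fact (k - 1) * fact (?n - k - 1) / real (?n - 1)) = of_real (fact (?n - 1) * split_weight ?n k)"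
      by (simp only:)
    then have 2: "of_nat (?n choose (k + 1)) * fact (k - 1) * fact (?n - k - 1) / of_nat (?n - 1) = fact (?n - 1) * complex_of_real (split_weight ?n k)"
      by simp
    have "of_nat (?n choose (k + 1)) * (fact (k - 1) * \<Phi> k * (fact (?n - k - 1) * \<Phi> (?n - k))) / of_nat (?n - 1)
       = (of_nat (?n choose (k + 1)) * fact (k - 1) * fact (?n - k - 1) / of_nat (?n - 1)) * (\<Phi> k * \<Phi> (?n - k))"
      by (simp only: divide_inverse mult_ac)
    then show ?thesis unfolding 1 2 by (simp only: mult_ac)
  qed
  note 3 = this
  have "(\<Sum>S\<in>{S. S \<noteq> {} \<and> S \<subseteq> V - {Min V}}. ?h S) / of_nat (?n - 1)
      = (\<Sum>k=1..<?n. fact (?n - 1) * (of_real (split_weight ?n k) * (\<Phi> k * \<Phi> (?n - k))))"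
    unfolding sum_nonempty_subsets_by_card[OF V(1) \<open>V \<noteq> {}\<close>]
    by (rule trans[OF sum_divide_distrib sum.cong[OF refl 3]])
  also have "\<dots> = fact (?n - 1) * (\<Sum>k=1..<?n. of_real (split_weight ?n k) * (\<Phi> k * \<Phi> (?n - k)))"
    by (simp only: sum_distrib_left)
  finally have 4: "(\<Sum>S\<in>{S. S \<noteq> {} \<and> S \<subseteq> V - {Min V}}. ?h S) / of_nat (?n - 1)
     = fact (?n - 1) * (\<Sum>k=1..<?n. of_real (split_weight ?n k) * (\<Phi> k * \<Phi> (?n - k)))" .
  show ?thesis
    unfolding fireproof_sum_rec[OF V p] times_divide_eq_right[symmetric] 4 by (simp add: algebra_simps)
qed

lemma fireproof_sum_single [simp]: "fireproof_sum p \<theta> {v} = cis \<theta>"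
proof -
  have "parent_maps {v} = {\<lambda>_. undefined}" by (simp add: parent_maps_def)
  then show ?thesis by (simp add: fireproof_sum_def parent_edges_def)
qed

text \<open>The factorials give it the shape of the hypothesis \<open>IH\<close> of
  \<open>fireproof_sum_rec_card\<close>, which is applied to \<open>V\<close> and to
  \<open>{1..card V}\<close>: the two right-hand sides coincide.\<close>

lemma fireproof_sum_card:
  assumes p: "0 \<le> p" "p \<le> 1"
  shows "finite V \<Longrightarrow> V \<noteq> {} \<Longrightarrow>
    fireproof_sum p \<theta> V = fact (card V - 1) * (fireproof_sum p \<theta> {1..card V} / fact (card V - 1))"
proof (induction "card V" arbitrary: V rule: less_induct)
  case less
  show ?case
  proof (cases "card V = 1")
    case True
    then obtain v where "V = {v}" by (auto simp: card_1_singleton_iff)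
    then show ?thesis by simp
  next
    case False
    then have V: "2 \<le> card V" using less.prems by (metis One_nat_def Suc_1 Suc_leI card_gt_0_iff le_neq_implies_less)
    have c: "card {1..card V} = card V" by simp
    have IH: "fireproof_sum p \<theta> W = fact (card W - 1) * (fireproof_sum p \<theta> {1..card W} / fact (card W - 1))"
      if "finite W" "W \<noteq> {}" "card W < card V" for W
      using less.hyps that by blast
    have "fireproof_sum p \<theta> V = fireproof_sum p \<theta> {1..card V}"
      by (rule trans[OF fireproof_sum_rec_card[OF p less.prems(1) V IH]
            fireproof_sum_rec_card[OF p, of "{1..card V}" \<theta>, unfolded c, OF _ V IH, symmetric]]) simp_all
    then show ?thesis by simp
  qed
qed

lemma split_recursion_fireproof:
  assumes p: "0 \<le> p" "p \<le> 1"
  shows "split_recursion (\<lambda>n. fireproof_sum p \<theta> {1..n} / fact (n - 1)) p \<theta>"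
proof
  fix n :: nat assume n: "2 \<le> n"
  have c: "card {1..n} = n" by simp
  have "fireproof_sum p \<theta> {1..n} = fact (n - 1) * (of_real p + of_real (1 - p) *
     (\<Sum>k=1..<n. of_real (split_weight n k) *
       (fireproof_sum p \<theta> {1..k} / fact (k - 1) * (fireproof_sum p \<theta> {1..n - k} / fact (n - k - 1)))))"
    by (rule fireproof_sum_rec_card[OF p, of "{1..n}" \<theta>, unfolded c, OF _ n fireproof_sum_card[OF p]]) simp_all
  then show "fireproof_sum p \<theta> {1..n} / fact (n - 1) = of_real p + of_real (1 - p) *
     (\<Sum>k=1..<n. of_real (split_weight n k) *
       (fireproof_sum p \<theta> {1..k} / fact (k - 1) * (fireproof_sum p \<theta> {1..n - k} / fact (n - k - 1))))"
    by simp
qed (use p in \<open>simp_all add: atLeastAtMost_singleton\<close>)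

section \<open>Recursive trees as parent maps\<close>

lemma simple_path_single [simp]: "simple_path E [u]"
  by (simp add: simple_path_def)

lemma simple_path_snoc:
  "simple_path E (xs @ [z]) \<longleftrightarrow> xs = [] \<or> simple_path E xs \<and> z \<notin> set xs \<and> {last xs, z} \<in> E"
  by (auto simp: simple_path_def successively_append_iff)

lemma simple_path_appendD:
  assumes "simple_path E (xs @ ys)"
  shows "xs \<noteq> [] \<Longrightarrow> simple_path E xs" "ys \<noteq> [] \<Longrightarrow> simple_path E ys"
  using assms by (auto simp: simple_path_def successively_append_iff)

text \<open>A walk becomes a path by cutting back to the earlier visit whenever a vertex recurs. The
  set \<open>A\<close> keeps control of the vertices used, which later allows a path to avoid a
  given vertex.\<close>

lemma rtrancl_simple_path:
  assumes "(u, w) \<in> {(a, b). {a, b} \<in> E \<and> a \<in> A \<and> b \<in> A}\<^sup>*" "u \<in> A"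
  shows "\<exists>xs. simple_path E xs \<and> hd xs = u \<and> last xs = w \<and> set xs \<subseteq> A"
  using assms(1)
proof (induction rule: rtrancl_induct)
  case base
  then show ?case using assms(2) by (intro exI[of _ "[u]"]) simp
next
  case (step y z)
  then obtain xs where xs: "simple_path E xs" "hd xs = u" "last xs = y" "set xs \<subseteq> A" by blast
  then have "xs \<noteq> []" by (simp add: simple_path_def)
  show ?case
  proof (cases "z \<in> set xs")
    case True
    then obtain ys zs where "xs = ys @ z # zs" by (meson split_list)
    then have split: "xs = (ys @ [z]) @ zs" by simp
    have "simple_path E (ys @ [z])" by (rule simple_path_appendD(1)[of E _ zs]) (use xs(1) split in simp_all)
    moreover have "hd (ys @ [z]) = u" using xs(2) unfolding split by (cases ys) auto
    moreover have "set (ys @ [z]) \<subseteq> A" using xs(4) unfolding split by auto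
    ultimately show ?thesis by (intro exI[of _ "ys @ [z]"]) simp
  next
    case False
    from step.hyps(2) have z: "{y, z} \<in> E" "z \<in> A" by auto
    have "simple_path E (xs @ [z])" using xs False z by (simp add: simple_path_snoc)
    then show ?thesis using xs z \<open>xs \<noteq> []\<close> by (intro exI[of _ "xs @ [z]"]) simp
  qed
qed

lemma simple_path_rtrancl:
  "simple_path E xs \<Longrightarrow> set xs \<subseteq> A \<Longrightarrow> (hd xs, last xs) \<in> {(a, b). {a, b} \<in> E \<and> a \<in> A \<and> b \<in> A}\<^sup>*"
proof (induction xs rule: rev_induct)
  case (snoc z xs)
  show ?case
  proof (cases "xs = []")
    case False
    then have "simple_path E xs" "{last xs, z} \<in> E" using snoc.prems by (simp_all add: simple_path_snoc)
    moreover have "last xs \<in> A" using False snoc.prems(2) last_in_set by auto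
    ultimately have "(hd xs, last xs) \<in> {(a, b). {a, b} \<in> E \<and> a \<in> A \<and> b \<in> A}\<^sup>*"
      "(last xs, z) \<in> {(a, b). {a, b} \<in> E \<and> a \<in> A \<and> b \<in> A}"
      using snoc by simp_all
    then have "(hd xs, z) \<in> {(a, b). {a, b} \<in> E \<and> a \<in> A \<and> b \<in> A}\<^sup>*" by (rule rtrancl_into_rtrancl)
    then show ?thesis using False by simp
  qed simp
qed (simp add: simple_path_def)

lemma simple_cycle_nth:
  assumes "simple_cycle E xs" "j < length xs"
  shows "{xs ! j, xs ! (Suc j mod length xs)} \<in> E"
proof (cases "Suc j = length xs")
  case True
  have "xs \<noteq> []" using assms(2) by auto
  then have "last xs = xs ! j" "hd xs = xs ! 0"
    using last_conv_nth[of xs] hd_conv_nth[of xs] by (simp_all flip: True)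
  then show ?thesis using assms True by (simp add: simple_cycle_def)
next
  case False
  then have "successively (\<lambda>u v. {u, v} \<in> E) xs" "Suc j < length xs"
    using assms by (auto simp: simple_cycle_def simple_path_def)
  then show ?thesis by (simp add: successively_conv_nth)
qed

section \<open>Parent maps yield recursive trees\<close>

lemma parent_edge_less:
  assumes f: "f \<in> parent_maps V" and e: "{a, b} \<in> parent_edges V f" "a < b"
  shows "a = f b" "b \<in> V - {Min V}"
proof -
  obtain v where v: "v \<in> V - {Min V}" "{a, b} = {f v, v}" using e by (auto simp: parent_edges_def)
  then have "f v < v" using parent_mapsD[OF f, of v] by simp
  with v e(2) have "b = v \<and> a = f v" by (auto simp: doubleton_eq_iff)
  with v show "a = f b" "b \<in> V - {Min V}" by auto
qed

lemma parent_edge_not_refl: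
  assumes f: "f \<in> parent_maps V" and e: "{a, b} \<in> parent_edges V f"
  shows "a \<noteq> b"
proof
  assume "a = b"
  obtain v where v: "v \<in> V - {Min V}" "{a, b} = {f v, v}" using e by (auto simp: parent_edges_def)
  then have "f v < v" using parent_mapsD[OF f, of v] by simp
  with v \<open>a = b\<close> show False by (auto simp: doubleton_eq_iff)
qed

lemma tree_on_parent_edges:
  assumes V: "finite V" and f: "f \<in> parent_maps V"
  shows "tree_on V (parent_edges V f)"
  unfolding tree_on_def
proof (intro conjI ballI)
  let ?E = "parent_edges V f"
  let ?r = "{(a, b). {a, b} \<in> ?E \<and> a \<in> V \<and> b \<in> V}"
  show "?E \<subseteq> {e. e \<subseteq> V \<and> card e = 2}"
  proof
    fix e assume "e \<in> ?E"
    then obtain v where v: "v \<in> V - {Min V}" "e = {f v, v}" by (auto simp: parent_edges_def)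
    then have "f v \<in> V" "f v < v" using parent_mapsD[OF f, of v] by auto
    then show "e \<in> {e. e \<subseteq> V \<and> card e = 2}" using v by simp
  qed
  have root: "v \<in> V \<Longrightarrow> (Min V, v) \<in> ?r\<^sup>*" for v
  proof (induction v rule: less_induct)
    case (less v)
    show ?case
    proof (cases "v = Min V")
      case False
      then have fv: "f v \<in> V" "f v < v" using parent_mapsD[OF f less.prems] by auto
      have "{f v, v} \<in> ?E" using False less.prems unfolding parent_edges_def by blast
      then have "(f v, v) \<in> ?r" using fv less.prems by simp
      then show ?thesis by (rule rtrancl_into_rtrancl[OF less.IH[OF fv(2,1)]])
    qed simp
  qed
  have "sym ?r" by (auto simp: sym_def insert_commute)
  then have sym: "sym (?r\<^sup>*)" by (rule sym_rtrancl)
  fix u v assume uv: "u \<in> V" "v \<in> V"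
  have "(u, v) \<in> ?r\<^sup>*"
    by (rule rtrancl_trans[OF symD[OF sym root[OF uv(1)]] root[OF uv(2)]])
  from rtrancl_simple_path[OF this uv(1)]
  show "\<exists>xs. simple_path ?E xs \<and> hd xs = u \<and> last xs = v" by blast
next
  let ?E = "parent_edges V f"
  show "\<nexists>xs. simple_cycle ?E xs"
  proof
    assume "\<exists>xs. simple_cycle ?E xs"
    then obtain xs where xs: "simple_cycle ?E xs" by blast
    define L where "L = length xs"
    have L: "3 \<le> L" "distinct xs" using xs by (auto simp: L_def simple_cycle_def simple_path_def)
    have "xs \<noteq> []" using L by (auto simp: L_def)
    \<comment> \<open>Both neighbours of the largest vertex of a cycle are smaller, hence equal to
      its parent; but on a cycle of length at least 3 they are distinct.\<close>
    then have "Max (set xs) \<in> set xs" by simp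
    then obtain i where i: "i < L" "xs ! i = Max (set xs)" by (auto simp: in_set_conv_nth L_def)
    have parent: "xs ! j = f (xs ! i)" if "j < L" "{xs ! j, xs ! i} \<in> ?E" for j
    proof -
      have "xs ! j \<le> xs ! i" using that(1) i by (simp add: L_def)
      then have "xs ! j < xs ! i" using parent_edge_not_refl[OF f that(2)] by simp
      then show ?thesis using parent_edge_less(1)[OF f that(2)] by simp
    qed
    define j where "j = (if i = 0 then L - 1 else i - 1)"
    have j: "j < L" "Suc j mod L = i" using i L by (auto simp: j_def)
    have k: "Suc i mod L < L" using L by simp
    have "xs ! j = f (xs ! i)"
      using simple_cycle_nth[OF xs, of j] j by (intro parent) (simp_all flip: L_def)
    moreover have "xs ! (Suc i mod L) = f (xs ! i)"
      using simple_cycle_nth[OF xs, of i] i k by (intro parent) (simp_all add: insert_commute flip: L_def)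
    ultimately have "j = Suc i mod L"
      using L j k nth_eq_iff_index_eq[of xs j "Suc i mod L"] by (simp add: L_def)
    then show False using i L by (auto simp: j_def mod_Suc split: if_splits)
  qed
qed

lemma sorted_simple_path_parent_edges:
  assumes f: "f \<in> parent_maps V"
  shows "simple_path (parent_edges V f) xs \<Longrightarrow> hd xs = Min V \<Longrightarrow> sorted_wrt (<) xs"
proof (induction xs rule: rev_induct)
  case (snoc z xs)
  show ?case
  proof (cases "xs = []")
    case False
    then have xs: "simple_path (parent_edges V f) xs" "z \<notin> set xs" "{last xs, z} \<in> parent_edges V f" "hd xs = Min V"
      using snoc.prems by (auto simp: simple_path_snoc)
    then have IH: "sorted_wrt (<) xs" by (intro snoc.IH)
    \<comment> \<open>A descent would lead to the parent of \<open>last xs\<close>; the preceding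
      ascent came from that same parent, so the path would repeat a vertex.\<close>
    have last: "last xs < z"
    proof (rule ccontr)
      assume "\<not> last xs < z"
      then have "z < last xs" using parent_edge_not_refl[OF f xs(3)] by simp
      moreover have "{z, last xs} \<in> parent_edges V f" using xs(3) by (simp add: insert_commute)
      ultimately have z: "z = f (last xs)" "last xs \<noteq> Min V" using parent_edge_less[OF f] by auto
      obtain ys y where ys: "xs = ys @ [y]" using False by (metis append_butlast_last_id)
      have "ys \<noteq> []" using z(2) xs(4) ys by auto
      then have "{last ys, y} \<in> parent_edges V f" using xs(1) ys by (simp add: simple_path_snoc)
      moreover have "last ys < y" using IH \<open>ys \<noteq> []\<close> by (simp add: ys sorted_wrt_append)
      ultimately have "last ys = f y" by (rule parent_edge_less(1)[OF f])
      then have "z \<in> set ys" using z(1) ys last_in_set[OF \<open>ys \<noteq> []\<close>] by simp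
      then show False using xs(2) ys by simp
    qed
    have "x \<le> last xs" if "x \<in> set xs" for x
    proof -
      obtain ys y where ys: "xs = ys @ [y]" using False by (metis append_butlast_last_id)
      then show ?thesis using IH that by (auto simp: sorted_wrt_append)
    qed
    then have "x < z" if "x \<in> set xs" for x using last that by (meson le_less_trans)
    then show ?thesis using IH by (simp add: sorted_wrt_append)
  qed simp
qed simp

lemma inj_on_parent_edges: "inj_on (parent_edges V) (parent_maps V)"
proof (rule inj_onI)
  fix f g assume fg: "f \<in> parent_maps V" "g \<in> parent_maps V" "parent_edges V f = parent_edges V g"
  have "f v = g v" if v: "v \<in> V - {Min V}" for v
  proof -
    have "{f v, v} \<in> parent_edges V g" using v fg(3) unfolding parent_edges_def by blast
    then show ?thesis using parent_edge_less(1)[OF fg(2)] parent_mapsD(2)[OF fg(1)] v by blast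
  qed
  then show "f = g" using fg(1,2) unfolding parent_maps_def by (rule PiE_ext[rotated 2])
qed

section \<open>Recursive trees come from parent maps\<close>

lemma simple_path_subset:
  assumes "E \<subseteq> {e. e \<subseteq> V \<and> card e = 2}" "simple_path E xs" "hd xs \<in> V"
  shows "set xs \<subseteq> V"
  using assms(2,3)
proof (induction xs rule: rev_induct)
  case (snoc z xs)
  show ?case
  proof (cases "xs = []")
    case False
    then have "simple_path E xs" "{last xs, z} \<in> E" "hd xs \<in> V"
      using snoc.prems by (simp_all add: simple_path_snoc)
    then show ?thesis using snoc.IH assms(1) by auto
  qed (use snoc.prems in simp)
qed simp

text \<open>A maximal simple path from the root ends in a leaf, so the sortedness condition on root-to-leaf
  paths extends to all simple paths from the root.\<close>

lemma recursive_tree_path_sorted: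
  assumes E: "E \<in> recursive_trees n" and n: "1 \<le> n" and xs: "simple_path E xs" "hd xs = 1"
  shows "sorted_wrt (<) xs"
proof -
  have tree: "tree_on {1..n} E" using E by (simp add: recursive_trees_def)
  have edges: "E \<subseteq> {e. e \<subseteq> {1..n} \<and> card e = 2}" and acyclic: "\<And>xs. \<not> simple_cycle E xs"
    using tree by (auto simp: tree_on_def)
  have "xs \<noteq> []" using xs by (simp add: simple_path_def)
  let ?P = "\<lambda>ys. simple_path E (xs @ ys)"
  have hd1: "hd (xs @ ys) = 1" for ys using xs(2) \<open>xs \<noteq> []\<close> by simp
  have "length ys < Suc n" if "?P ys" for ys
  proof -
    have "set (xs @ ys) \<subseteq> {1..n}"
      using that hd1 n by (intro simple_path_subset[OF edges]) auto
    then have "card (set (xs @ ys)) \<le> n" using card_mono[of "{1..n}"] by fastforce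
    moreover have "distinct (xs @ ys)" using that by (simp add: simple_path_def)
    ultimately show ?thesis by (metis distinct_card length_append le_add2 le_imp_less_Suc order_trans)
  qed
  then obtain ys where ys: "?P ys" "\<And>ys'. ?P ys' \<Longrightarrow> length ys' \<le> length ys"
    using ex_has_greatest_nat[of ?P "[]" length "Suc n"] xs(1) by (metis append_Nil2 less_imp_le)
  let ?zs = "xs @ ys"
  have "sorted_wrt (<) ?zs"
  proof (cases "length ?zs = 1")
    case True
    \<comment> \<open>The root never counts as a leaf, so a maximal path reduced to the root is
      treated apart.\<close>
    then obtain a where "?zs = [a]" by (metis One_nat_def length_0_conv length_Suc_conv)
    then show ?thesis by simp
  next
    case False
    have ne: "?zs \<noteq> []" using \<open>xs \<noteq> []\<close> by simp
    then obtain us v where us: "?zs = us @ [v]" by (metis append_butlast_last_id)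
    with False have "us \<noteq> []" by auto
    then have x: "simple_path E us" "v \<notin> set us" "{last us, v} \<in> E"
      using ys(1) unfolding us by (simp_all add: simple_path_snoc)
    have "hd us = 1" using hd1[of ys] \<open>us \<noteq> []\<close> unfolding us by simp
    then have "v \<noteq> 1" using x(2) \<open>us \<noteq> []\<close> hd_in_set by metis
    have vV: "v \<in> {1..n}" using x(3) edges by auto
    \<comment> \<open>A second edge at \<open>v\<close>, leading to \<open>w\<close>, would prolong
      the maximal path if \<open>w\<close> is new, and would close a cycle if \<open>w\<close> is on
      the path.\<close>
    have unique: "e = {last us, v}" if e: "e \<in> E" "v \<in> e" for e
    proof (rule ccontr)
      assume ne': "e \<noteq> {last us, v}"
      have "card e = 2" using e edges by auto
      then obtain w where w: "e = {v, w}" "w \<noteq> v" using e(2) by (metis card_2_iff doubleton_eq_iff insertE singletonD)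
      with ne' have "w \<noteq> last us" by (auto simp: insert_commute)
      show False
      proof (cases "w \<in> set us")
        case False
        have "simple_path E (us @ [v])" using ys(1) by (simp only: us)
        then have "simple_path E ((us @ [v]) @ [w])"
          using False e(1) w by (subst simple_path_snoc) simp
        moreover have "(us @ [v]) @ [w] = xs @ (ys @ [w])" by (simp only: us[symmetric] append_assoc)
        ultimately have "?P (ys @ [w])" by (simp only:)
        from ys(2)[OF this] show False by simp
      next
        case True
        then obtain as bs where split: "us = as @ w # bs" by (meson split_list)
        then have "bs \<noteq> []" using \<open>w \<noteq> last us\<close> by auto
        have "simple_path E (as @ (w # bs @ [v]))" using ys(1) unfolding us split by simp
        then have "simple_path E (w # bs @ [v])" by (rule simple_path_appendD(2)) simp
        moreover have "3 \<le> length (w # bs @ [v])" using \<open>bs \<noteq> []\<close> by (cases bs) auto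
        ultimately have "simple_cycle E (w # bs @ [v])" using e(1) w by (simp add: simple_cycle_def)
        with acyclic show False by blast
      qed
    qed
    have "{e \<in> E. v \<in> e} = {{last us, v}}"
    proof
      show "{e \<in> E. v \<in> e} \<subseteq> {{last us, v}}" using unique by blast
      show "{{last us, v}} \<subseteq> {e \<in> E. v \<in> e}" using x(3) by simp
    qed
    then have "leaf_of 1 {1..n} E (last ?zs)"
      using vV \<open>v \<noteq> 1\<close> unfolding us by (simp add: leaf_of_def)
    then show ?thesis using E ys(1) hd1 by (simp add: recursive_trees_def)
  qed
  then show ?thesis by (simp add: sorted_wrt_append)
qed

text \<open>The predecessor of \<open>v\<close> on the path from the root is a smaller neighbour. If
  there were two, the increasing paths from the root to them would connect them below
  \<open>v\<close>, and joining both ends to \<open>v\<close> would close a cycle.\<close>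

lemma recursive_tree_parent:
  assumes E: "E \<in> recursive_trees n" and n: "1 \<le> n" and v: "v \<in> {1..n}" "v \<noteq> 1"
  shows "\<exists>!u. u < v \<and> {u, v} \<in> E"
proof -
  have tree: "tree_on {1..n} E" using E by (simp add: recursive_trees_def)
  have path: "\<exists>xs. simple_path E xs \<and> hd xs = 1 \<and> last xs = u" if "u \<in> {1..n}" for u
  proof -
    have "1 \<in> {1..n}" using n by simp
    with tree that show ?thesis unfolding tree_on_def by blast
  qed
  have edges: "E \<subseteq> {e. e \<subseteq> {1..n} \<and> card e = 2}" and acyclic: "\<And>xs. \<not> simple_cycle E xs"
    using tree by (auto simp: tree_on_def)
  obtain xs where xs: "simple_path E xs" "hd xs = 1" "last xs = v" using path[OF v(1)] by blast
  have "xs \<noteq> []" using xs by (simp add: simple_path_def)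
  then obtain us where us: "xs = us @ [v]" using xs(3) by (metis append_butlast_last_id)
  have "us \<noteq> []" using xs(2) v(2) us by auto
  then have "{last us, v} \<in> E" using xs(1) us by (simp add: simple_path_snoc)
  moreover have "last us < v"
    using recursive_tree_path_sorted[OF E n xs(1,2)] \<open>us \<noteq> []\<close> by (simp add: us sorted_wrt_append)
  moreover have "u = w" if u: "u < v" "{u, v} \<in> E" and w: "w < v" "{w, v} \<in> E" for u w
  proof (rule ccontr)
    assume "u \<noteq> w"
    let ?r = "{(a, b). {a, b} \<in> E \<and> a \<in> {..<v} \<and> b \<in> {..<v}}"
    have root: "(1, x) \<in> ?r\<^sup>*" if x: "x < v" "{x, v} \<in> E" for x
    proof -
      have "x \<in> {1..n}" using x edges by auto
      then obtain ys where ys: "simple_path E ys" "hd ys = 1" "last ys = x" using path by blast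
      then have "ys \<noteq> []" by (simp add: simple_path_def)
      then obtain zs where zs: "ys = zs @ [x]" using ys(3) by (metis append_butlast_last_id)
      have "set ys \<subseteq> {..<v}"
        using recursive_tree_path_sorted[OF E n ys(1,2)] x by (auto simp: zs sorted_wrt_append)
      from simple_path_rtrancl[OF ys(1) this] show ?thesis by (simp only: ys)
    qed
    have "sym ?r" by (auto simp: sym_def insert_commute)
    then have sym: "sym (?r\<^sup>*)" by (rule sym_rtrancl)
    have "(u, w) \<in> ?r\<^sup>*" by (rule rtrancl_trans[OF symD[OF sym root[OF u]] root[OF w]])
    from rtrancl_simple_path[OF this] u(1)
    obtain ps where ps: "simple_path E ps" "hd ps = u" "last ps = w" "set ps \<subseteq> {..<v}" by auto
    then have "ps \<noteq> []" by (simp add: simple_path_def)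
    have "v \<notin> set ps" using ps(4) by auto
    then have "simple_path E (ps @ [v])" using ps w by (simp add: simple_path_snoc)
    moreover have "2 \<le> length ps"
      using \<open>u \<noteq> w\<close> ps(2,3) \<open>ps \<noteq> []\<close> by (cases ps; cases "tl ps") auto
    ultimately have "simple_cycle E (ps @ [v])"
      using u(2) ps(2) \<open>ps \<noteq> []\<close> by (simp add: simple_cycle_def insert_commute)
    with acyclic show False by blast
  qed
  ultimately show ?thesis by blast
qed

lemma recursive_trees_eq:
  assumes n: "1 \<le> n"
  shows "recursive_trees n = parent_edges {1..n} ` parent_maps {1..n}"
proof
  let ?V = "{1..n}"
  have MinV: "Min ?V = 1" using n by (intro Min_eqI) auto
  show "parent_edges ?V ` parent_maps ?V \<subseteq> recursive_trees n"
    using tree_on_parent_edges[of ?V] sorted_simple_path_parent_edges[of _ ?V]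
    unfolding recursive_trees_def MinV by blast
  show "recursive_trees n \<subseteq> parent_edges ?V ` parent_maps ?V"
  proof
    fix E assume E: "E \<in> recursive_trees n"
    then have edges: "E \<subseteq> {e. e \<subseteq> ?V \<and> card e = 2}" by (simp add: recursive_trees_def tree_on_def)
    define f where "f = restrict (\<lambda>v. THE u. u < v \<and> {u, v} \<in> E) (?V - {Min ?V})"
    have f: "f v < v" "{f v, v} \<in> E" if "v \<in> ?V - {Min ?V}" for v
    proof -
      have "\<exists>!u. u < v \<and> {u, v} \<in> E" using recursive_tree_parent[OF E n] that unfolding MinV by blast
      from theI'[OF this] show "f v < v" "{f v, v} \<in> E" using that by (simp_all add: f_def)
    qed
    have f_eq: "f v = u" if "v \<in> ?V - {Min ?V}" "u < v" "{u, v} \<in> E" for u v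
    proof -
      have "\<exists>!u. u < v \<and> {u, v} \<in> E" using recursive_tree_parent[OF E n] that unfolding MinV by blast
      then show ?thesis using f[OF that(1)] that(2,3) by blast
    qed
    have "f \<in> parent_maps ?V"
      unfolding parent_maps_def
    proof (rule PiE_I)
      fix v assume v: "v \<in> ?V - {Min ?V}"
      then have "f v \<in> ?V" using f(2)[OF v] edges by blast
      then show "f v \<in> {u \<in> ?V. u < v}" using f(1)[OF v] by simp
    next
      fix v assume "v \<notin> ?V - {Min ?V}"
      then show "f v = undefined" unfolding f_def restrict_apply by (rule if_not_P)
    qed
    moreover have "E = parent_edges ?V f"
    proof
      show "parent_edges ?V f \<subseteq> E" using f(2) unfolding parent_edges_def by blast
      show "E \<subseteq> parent_edges ?V f"
      proof
        fix e assume e: "e \<in> E"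
        then have "card e = 2" "e \<subseteq> ?V" using edges by auto
        then obtain a b where ab: "e = {a, b}" "a < b"
          by (metis card_2_iff insert_commute linorder_neqE_nat)
        then have b: "b \<in> ?V - {Min ?V}" using \<open>e \<subseteq> ?V\<close> unfolding MinV by auto
        then have "f b = a" using f_eq ab e by blast
        then show "e \<in> parent_edges ?V f" using ab b unfolding parent_edges_def by blast
      qed
    qed
    ultimately show "E \<in> parent_edges ?V ` parent_maps ?V" by blast
  qed
qed

section \<open>The limit theorem\<close>

lemma expectation_fireproof_count:
  assumes n: "1 \<le> n" and p: "0 \<le> p" "p \<le> 1"
  shows "measure_pmf.expectation (fireproof_count_pmf n p) (\<lambda>k. cis (real k * \<theta>))
    = fireproof_sum p \<theta> {1..n} / fact (n - 1)"
proof -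
  let ?V = "{1..n}"
  have V: "finite ?V" "?V \<noteq> {}" "card ?V = n" using n by auto
  have inj: "inj_on (parent_edges ?V) (parent_maps ?V)" by (rule inj_on_parent_edges)
  have card: "card (recursive_trees n) = fact (n - 1)"
    unfolding recursive_trees_eq[OF n] using card_image[OF inj] card_parent_maps[OF V(1)] V(3) by simp
  have fin: "finite (recursive_trees n)"
    unfolding recursive_trees_eq[OF n] by simp
  have ne: "recursive_trees n \<noteq> {}"
    using card by (metis card.empty fact_nonzero)
  have finE: "finite E" if "E \<in> recursive_trees n" for E
    using that unfolding recursive_trees_eq[OF n] by (auto simp: parent_edges_def)
  have fd: "finite (set_pmf (fire_dynamics E p))" if "E \<in> recursive_trees n" for E
    using finE[OF that] by (auto simp: fire_dynamics_def finite_set_pmf_fire_run)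
  have "measure_pmf.expectation (fireproof_count_pmf n p) (\<lambda>k. cis (real k * \<theta>))
      = (\<Sum>E\<in>recursive_trees n. measure_pmf.expectation
          (map_pmf (\<lambda>s. card (fireproof_vertices ?V E s)) (fire_dynamics E p)) (\<lambda>k. cis (real k * \<theta>))
          /\<^sub>R real (card (recursive_trees n)))"
    unfolding fireproof_count_pmf_def using fin ne fd
    by (intro pmf_expectation_bind_pmf_of_set) auto
  also have "\<dots> = (\<Sum>E\<in>recursive_trees n. fireproof_char p \<theta> ?V E / fact (n - 1))"
    unfolding card
    by (intro sum.cong refl) (simp add: fireproof_char_def fire_mean_def fire_dynamics_def scaleR_conv_of_real divide_inverse)
  also have "\<dots> = (\<Sum>f\<in>parent_maps ?V. fireproof_char p \<theta> ?V (parent_edges ?V f) / fact (n - 1))"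
    unfolding recursive_trees_eq[OF n] by (rule sum.reindex_cong[OF inj refl refl])
  finally show ?thesis by (simp add: fireproof_sum_def sum_divide_distrib)
qed

theorem theorem1:
  fixes p :: "nat \<Rightarrow> real"
  assumes "\<And>n. n \<ge> 1 \<Longrightarrow> 0 \<le> p n \<and> p n \<le> 1"
    and "p \<longlonglongrightarrow> 0"
    and "filterlim (\<lambda>n. real n * p n / ln (real n)) at_top sequentially"
  shows "weak_conv_m
    (\<lambda>n. distr (measure_pmf (fireproof_count_pmf n (p n))) borel
           (\<lambda>k. p n / ln (1 / p n) * real k))
    (density lborel (\<lambda>x. ennreal (exponential_density 1 x)))"
proof (rule levy_continuity)
  let ?c = "\<lambda>n. p n / ln (1 / p n)"
  let ?D = "\<lambda>n. distr (measure_pmf (fireproof_count_pmf n (p n))) borel (\<lambda>k. ?c n * real k)"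
  show "real_distribution (?D n)" for n
    by (intro prob_space.real_distribution_distr prob_space_measure_pmf) simp
  show "real_distribution (density lborel (\<lambda>x. ennreal (exponential_density 1 x)))"
    by (rule real_distribution_exponential) simp
  fix t
  \<comment> \<open>The first argument fixes the parameter and the frequency, the second is the size
    of the tree; the recursion runs in the second.\<close>
  define \<phi> where "\<phi> = (\<lambda>n k. fireproof_sum (p n) (t * p n / ln (1 / p n)) {1..k} / fact (k - 1))"
  have "(\<lambda>n. \<phi> n n) \<longlonglongrightarrow> 1 / (1 - \<i> * of_real t)"
    using assms(1) unfolding \<phi>_def
    by (intro split_recursion_limit[OF _ assms(2,3)] split_recursion_fireproof) auto
  moreover have "char (?D n) t = \<phi> n n" if n: "1 \<le> n" for n
  proof -
    have "char (?D n) t = measure_pmf.expectation (fireproof_count_pmf n (p n)) (\<lambda>k. iexp (t * (?c n * real k)))"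
      unfolding char_def by (rule integral_distr) auto
    also have "(\<lambda>k. iexp (t * (?c n * real k))) = (\<lambda>k. cis (real k * (t * p n / ln (1 / p n))))"
      by (simp add: cis_conv_exp mult_ac)
    also have "measure_pmf.expectation (fireproof_count_pmf n (p n)) \<dots> = \<phi> n n"
      unfolding \<phi>_def by (rule expectation_fireproof_count[OF n]) (use assms(1)[OF n] in auto)
    finally show ?thesis .
  qed
  \<comment> \<open>The identity holds from \<open>n = 1\<close> on, where the bounds on
    \<open>p n\<close> are available; the limit does not see size 0.\<close>
  then have "eventually (\<lambda>n. \<phi> n n = char (?D n) t) sequentially"
    by (intro eventually_sequentiallyI[of 1]) simp
  ultimately have "(\<lambda>n. char (?D n) t) \<longlonglongrightarrow> 1 / (1 - \<i> * of_real t)"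
    by (rule Lim_transform_eventually)
  then show "(\<lambda>n. char (?D n) t) \<longlonglongrightarrow> char (density lborel (\<lambda>x. ennreal (exponential_density 1 x))) t"
    unfolding char_exponential .
qed

end
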